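(* Let $n\ge 1$ and $0\le m\le n$ be integers, and let $r_1>r_2>\cdots>r_m\ge 0$ and $s_{m+1}>\cdots>s_n\ge 0$ be sequences of non-negative integers such that $-r_j-\tfrac12\ne s_k+\tfrac12$ for all $1\le j\le m$ and $m+1\le k\le n$. Put $\mathbf r=(r_1,\dots,r_m)$, $\mathbf s=(s_{m+1},\dots,s_n)$, and let $G_{\mathbf r,\mathbf s}(q)$ be the coefficient of $t_1^{r_1+\frac12}\cdots t_m^{r_m+\frac12}\,t_{m+1}^{-s_{m+1}-\frac12}\cdots t_n^{-s_n-\frac12}$ in $F(t_1,\dots,t_n)$. Then, as $y\to0$ (with $y>0$), $$G_{\mathbf r,\mathbf s}(e^{-2\pi y})=\frac1{2^n}\sum_{\substack{\nu_1,\dots,\nu_n\ge0\\ 0\le\ell_k\le\nu_k\ (1\le k\le n)\\ \ell\text{ even}}}(-1)^\nu2^\nu\pi^{\nu-\frac\ell2}i^\ell\,\frac{\Gamma\left(\frac{\ell+1}2\right)}{\sqrt\pi}\prod_{j=1}^m\frac{E_{\nu_j}(1)(-1)^{\ell_j}}{\ell_j!(\nu_j-\ell_j)!}\left(r_j+\tfrac12\right)^{\nu_j-\ell_j}\prod_{j=m+1}^n\frac{E_{\nu_j}(0)}{\ell_j!(\nu_j-\ell_j)!}\left(s_j+\tfrac12\right)^{\nu_j-\ell_j}\,y^{\nu-\frac\ell2}+O\left(e^{-a/y}\right),$$ where $a\in\mathbb R^+$, $\ell=\sum_{k=1}^n\ell_k$ and $\nu=\sum_{k=1}^n\nu_k$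.
   Context: $E_k(x)$ denotes the $k$th Euler polynomial, $\frac{2e^{xw}}{e^w+1}=\sum_{k\ge0}E_k(x)\frac{w^k}{k!}$. Fermionic Fock space: let $\psi(k+\tfrac12),\psi^*(k+\tfrac12)$, $k\in\mathbb Z$, satisfy $[\psi^*(\ell+\tfrac12),\psi(k+\tfrac12)]_+=\delta_{\ell+k+1,0}$ for $\ell,k\in\mathbb{Z}$, all other anticommutators being zero. $\mathcal F$ is the complex vector space generated from a vacuum vector $\mathbf 1$, annihilated by all $\psi(k+\tfrac12)$ and $\psi^*(k+\tfrac12)$ with $k\ge 0$, with basis the monomials $\psi(-n_a-\tfrac12)\cdots\psi(-n_1-\tfrac12)\psi^*(-m_b-\tfrac12)\cdots\psi^*(-m_1-\tfrac12)\mathbf 1$, where $n_a>\cdots>n_1\ge0$ and $m_b>\cdots>m_1\ge 0$. Such a monomial has charge $a-b$ and is an eigenvector of $L(0)$ with eigenvalue $\sum_i(n_i+\tfrac12)+\sum_i(m_i+\tfrac12)$. $\mathcal F_0$ is the span of the monomials of charge $0$. Let $A(t)=\sum_{\ell\in\mathbb Z}\psi^*(\ell+\tfrac12)\psi(-\ell-\tfrac12)\,t^{-\ell-\frac12}$, and define the Bloch-Okounkov $n$-point function (a formal series in the $t_j$, whose coefficients are power series in $q=e^{2\pi i\tau}$, $|q|<1$) by $$F(t_1,\dots,t_n)=\eta(\tau)\,\mathrm{tr}_{\mathcal F_0}A(t_1)\cdots A(t_n)\,q^{L(0)-\frac1{24}},\qquad \eta(\tau)=q^{\frac1{24}}\p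rod_{m\ge1}(1-q^m).$$
   Formalization: The infinite sum diverges for every y>0, so the equality is read as: for each K, G minus the terms with exponent ν−ℓ/2 ≤ K is O(y^{K+1}); and for some a, κ>0, G minus the terms with exponent ≤ κ/y is O(e^{-a/y}). *)

theory Defs
  imports
    "HOL-Analysis.Analysis"
    "HOL-Library.Landau_Symbols"
    "HOL-Library.FuncSet"
    "HOL-Computational_Algebra.Formal_Power_Series"
begin

definition euler_poly :: "nat \<Rightarrow> 'a::field_char_0 \<Rightarrow> 'a" where
  "euler_poly k x = fact k * fps_nth (2 * fps_exp x / (fps_exp 1 + 1)) k"

(* psi k and psis k stand for \<psi>(k + 1/2) and \<psi>*(k + 1/2). Hence \<psi>(-n - 1/2) is psi (- int n - 1).
   The monomial with N = {n_1 < ... < n_a} and M = {m_1 < ... < m_b} is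
   \<psi>(-n_a-1/2) ... \<psi>(-n_1-1/2) \<psi>*(-m_b-1/2) ... \<psi>*(-m_1-1/2) vac: fold applies the
   smallest element first, i.e. innermost. *)
definition fock_monomial ::
  "(int \<Rightarrow> 'f \<Rightarrow> 'f) \<Rightarrow> (int \<Rightarrow> 'f \<Rightarrow> 'f) \<Rightarrow> 'f \<Rightarrow> nat set \<times> nat set \<Rightarrow> 'f" where
  "fock_monomial psi psis vac = (\<lambda>(N, M).
     fold (\<lambda>n. psi (- int n - 1)) (sorted_list_of_set N)
       (fold (\<lambda>m. psis (- int m - 1)) (sorted_list_of_set M) vac))"

definition fock_index :: "(nat set \<times> nat set) set" where
  "fock_index = {(N, M). finite N \<and> finite M}"

locale fermionic_fock_space = vector_space smul
  for smul :: "complex \<Rightarrow> 'f::ab_group_add \<Rightarrow> 'f" +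
  fixes psi psis :: "int \<Rightarrow> 'f \<Rightarrow> 'f" and vac :: 'f
  assumes linear_psi: "Vector_Spaces.linear smul smul (psi k)"
    and linear_psis: "Vector_Spaces.linear smul smul (psis k)"
    and anticomm_psis_psi:
      "psis l (psi k v) + psi k (psis l v) = (if l + k + 1 = 0 then v else 0)"
    and anticomm_psi_psi: "psi l (psi k v) + psi k (psi l v) = 0"
    and anticomm_psis_psis: "psis l (psis k v) + psis k (psis l v) = 0"
    and psi_vac: "k \<ge> 0 \<Longrightarrow> psi k vac = 0"
    and psis_vac: "k \<ge> 0 \<Longrightarrow> psis k vac = 0"
    and inj_monomials: "inj_on (fock_monomial psi psis vac) fock_index"
    and independent_monomials: "\<not> dependent (fock_monomial psi psis vac ` fock_index)"
    and span_monomials: "span (fock_monomial psi psis vac ` fock_index) = UNIV"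

definition fock_charge :: "nat set \<times> nat set \<Rightarrow> int" where
  "fock_charge = (\<lambda>(N, M). int (card N) - int (card M))"

definition L0_eigenvalue :: "nat set \<times> nat set \<Rightarrow> real" where
  "L0_eigenvalue = (\<lambda>(N, M). (\<Sum>n\<in>N. real n + 1/2) + (\<Sum>m\<in>M. real m + 1/2))"

(* tr_{F_0} X q^(L(0) - 1/24) for q = exp(2 pi i tau): the sum of the diagonal matrix entries of
   X q^(L(0) - 1/24) in the basis of F_0 given by the charge 0 monomials. On a monomial,
   q^(L(0) - 1/24) acts as the scalar below. *)
definition trace_F0 ::
  "(complex \<Rightarrow> 'f::ab_group_add \<Rightarrow> 'f) \<Rightarrow> (int \<Rightarrow> 'f \<Rightarrow> 'f) \<Rightarrow> (int \<Rightarrow> 'f \<Rightarrow> 'f) \<Rightarrow> 'f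
    \<Rightarrow> ('f \<Rightarrow> 'f) \<Rightarrow> complex \<Rightarrow> complex" where
  "trace_F0 smul psi psis vac X \<tau> =
     (\<Sum>\<^sub>\<infinity>b\<in>{b \<in> fock_index. fock_charge b = 0}.
        module.representation smul (fock_monomial psi psis vac ` fock_index)
          (X (smul (exp (2 * pi * \<i> * \<tau> * (of_real (L0_eigenvalue b) - 1/24)))
                    (fock_monomial psi psis vac b)))
          (fock_monomial psi psis vac b))"

definition dedekind_eta :: "complex \<Rightarrow> complex" where
  "dedekind_eta \<tau> =
     exp (2 * pi * \<i> * \<tau> / 24) * (\<Prod>m. 1 - exp (2 * pi * \<i> * \<tau> * of_nat (Suc m)))"

(* Formal series in half-integral powers of t are indexed by int: the index k belongs to t^(k + 1/2).
   In A(t), the power t^(-l - 1/2) has index k = - l - 1 and coefficient \<psi>*(l + 1/2) \<psi>(-l - 1/2),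
   that is psis l o psi (- l - 1) with l = - k - 1. *)
definition A_coeff :: "(int \<Rightarrow> 'f \<Rightarrow> 'f) \<Rightarrow> (int \<Rightarrow> 'f \<Rightarrow> 'f) \<Rightarrow> int \<Rightarrow> 'f \<Rightarrow> 'f" where
  "A_coeff psi psis k = psis (- k - 1) \<circ> psi k"

(* The coefficient of t_1^(k_1 + 1/2) ... t_n^(k_n + 1/2) in F(t_1, ..., t_n), ks = [k_1, ..., k_n]. *)
definition npoint_coeff ::
  "(complex \<Rightarrow> 'f::ab_group_add \<Rightarrow> 'f) \<Rightarrow> (int \<Rightarrow> 'f \<Rightarrow> 'f) \<Rightarrow> (int \<Rightarrow> 'f \<Rightarrow> 'f) \<Rightarrow> 'f
    \<Rightarrow> int list \<Rightarrow> complex \<Rightarrow> complex" where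
  "npoint_coeff smul psi psis vac ks \<tau> =
     dedekind_eta \<tau> * trace_F0 smul psi psis vac (foldr (\<lambda>k X. A_coeff psi psis k \<circ> X) ks id) \<tau>"

(* G_{r,s} as a function of tau. The exponents r_j + 1/2 and - s_j - 1/2 have the indices
   r_j and - s_j - 1. *)
definition G_coeff ::
  "(complex \<Rightarrow> 'f::ab_group_add \<Rightarrow> 'f) \<Rightarrow> (int \<Rightarrow> 'f \<Rightarrow> 'f) \<Rightarrow> (int \<Rightarrow> 'f \<Rightarrow> 'f) \<Rightarrow> 'f
    \<Rightarrow> nat \<Rightarrow> nat \<Rightarrow> (nat \<Rightarrow> nat) \<Rightarrow> (nat \<Rightarrow> nat) \<Rightarrow> complex \<Rightarrow> complex" where
  "G_coeff smul psi psis vac n m r s =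
     npoint_coeff smul psi psis vac
       (map (\<lambda>j. if j \<le> m then int (r j) else - int (s j) - 1) [1..<Suc n])"

definition asym_term ::
  "nat \<Rightarrow> nat \<Rightarrow> (nat \<Rightarrow> nat) \<Rightarrow> (nat \<Rightarrow> nat) \<Rightarrow> (nat \<Rightarrow> nat) \<Rightarrow> (nat \<Rightarrow> nat) \<Rightarrow> real \<Rightarrow> complex" where
  "asym_term n m r s \<nu> l y =
     (let \<nu>' = (\<Sum>k=1..n. \<nu> k); l' = (\<Sum>k=1..n. l k) in
        (-1) ^ \<nu>' * 2 ^ \<nu>' * of_real (pi powr (real \<nu>' - real l' / 2)) * \<i> ^ l'
      * of_real (Gamma ((real l' + 1) / 2) / sqrt pi)
      * (\<Prod>j=1..m. euler_poly (\<nu> j) 1 * (-1) ^ l j / (fact (l j) * fact (\<nu> j - l j))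
                     * (of_nat (r j) + 1/2) ^ (\<nu> j - l j))
      * (\<Prod>j=m+1..n. euler_poly (\<nu> j) 0 / (fact (l j) * fact (\<nu> j - l j))
                       * (of_nat (s j) + 1/2) ^ (\<nu> j - l j))
      * of_real (y powr (real \<nu>' - real l' / 2)))"

definition asym_index :: "nat \<Rightarrow> real \<Rightarrow> ((nat \<Rightarrow> nat) \<times> (nat \<Rightarrow> nat)) set" where
  "asym_index n K =
     {(\<nu>, l). \<nu> \<in> {1..n} \<rightarrow>\<^sub>E UNIV \<and> l \<in> (\<Pi>\<^sub>E k\<in>{1..n}. {0..\<nu> k}) \<and> even (\<Sum>k=1..n. l k)
        \<and> real (\<Sum>k=1..n. \<nu> k) - real (\<Sum>k=1..n. l k) / 2 \<le> K}"

lemma finite_asym_index: "finite (asym_index n K)"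
proof -
  define B where "B = nat \<lceil>2 * K\<rceil>"
  have bound: "\<nu> \<in> {1..n} \<rightarrow>\<^sub>E {0..B} \<and> l \<in> {1..n} \<rightarrow>\<^sub>E {0..B}" if "(\<nu>, l) \<in> asym_index n K" for \<nu> l
  proof -
    have le: "l k \<le> \<nu> k" if "k \<in> {1..n}" for k
      using \<open>(\<nu>, l) \<in> _\<close> that by (auto simp: asym_index_def PiE_iff)
    have "(\<Sum>k=1..n. l k) \<le> (\<Sum>k=1..n. \<nu> k)"
      by (rule sum_mono) (use le in auto)
    hence "real (\<Sum>k=1..n. l k) \<le> real (\<Sum>k=1..n. \<nu> k)"
      using of_nat_le_iff by blast
    moreover have "real (\<Sum>k=1..n. \<nu> k) - real (\<Sum>k=1..n. l k) / 2 \<le> K"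
      using that by (auto simp: asym_index_def)
    ultimately have "real (\<Sum>k=1..n. \<nu> k) \<le> 2 * K"
      by linarith
    hence sum: "(\<Sum>k=1..n. \<nu> k) \<le> B"
      unfolding B_def by linarith
    have "\<nu> k \<le> B" if "k \<in> {1..n}" for k
      using member_le_sum[of k "{1..n}" \<nu>] that sum by simp
    moreover from this have "l k \<le> B" if "k \<in> {1..n}" for k
      using le[OF that] that by (meson le_trans)
    ultimately show ?thesis
      using that by (simp add: asym_index_def PiE_iff)
  qed
  have "finite (({1..n} \<rightarrow>\<^sub>E {0..B}) \<times> ({1..n} \<rightarrow>\<^sub>E {0..B}))"
    by (intro finite_cartesian_product finite_PiE) auto
  moreover have "asym_index n K \<subseteq> ({1..n} \<rightarrow>\<^sub>E {0..B}) \<times> ({1..n} \<rightarrow>\<^sub>E {0..B})"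
    using bound by auto
  ultimately show ?thesis
    by (rule finite_subset[rotated])
qed

(* The part of the asymptotic series consisting of the (finitely many) terms whose exponent
   \<nu> - l/2 of y is at most K. The full series over all (\<nu>, l) diverges for every y > 0. *)
definition asym_sum ::
  "nat \<Rightarrow> nat \<Rightarrow> (nat \<Rightarrow> nat) \<Rightarrow> (nat \<Rightarrow> nat) \<Rightarrow> real \<Rightarrow> real \<Rightarrow> complex" where
  "asym_sum n m r s K y = 1 / 2 ^ n * (\<Sum>(\<nu>, l)\<in>asym_index n K. asym_term n m r s \<nu> l y)"

end

theory Submission
  imports Defs "HOL-Probability.Probability"
begin

text \<open>
  The operators in question are diagonal on monomials: the coefficient of \<open>A\<close> of index \<open>r \<ge> 0\<close> projects onto the
  monomials containing \<open>\<psi>*(-r-1/2)\<close>, the one of index \<open>-s-1\<close> onto those not containing \<open>\<psi>(-s-1/2)\<close>.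
  So \<open>G\<close> is, up to the eta factor, a generating function of pairs of finite sets with some elements prescribed or
  forbidden. Without any restrictions the charge \<open>c\<close> part is \<open>q^(c\<^sup>2/2) / \<Prod>(1 - q^i)\<close> by the Jacobi triple product,
  and \<open>q^(c\<^sup>2/2)\<close> is a value of the Gaussian characteristic function. Removing modes one at a time multiplies
  the integrand by Fermi factors, which yields for \<open>q = e^(-2\<pi>y)\<close> and a standard normal \<open>v\<close>

  \<open>G = E[\<Prod>\<^sub>j e^w\<^sub>j / (1 + e^w\<^sub>j) \<cdot> \<Prod>\<^sub>k 1 / (1 + e^w\<^sub>k)]\<close>, with
  \<open>w\<^sub>j = -i \<surd>(2\<pi>y) v - 2\<pi>y (r\<^sub>j + 1/2)\<close> and \<open>w\<^sub>k = i \<surd>(2\<pi>y) v - 2\<pi>y (s\<^sub>k + 1/2)\<close>.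

  Expanding the factors by the generating function of the Euler polynomials and integrating termwise gives the
  series. Giving \<open>v\<close> weight 1 and \<open>y\<close> weight 2, the pointwise truncation error at order \<open>K\<close> is at most
  \<open>C (\<beta>y)^(K+1)\<close> times a polynomial in \<open>v\<close>: for small \<open>v\<close> by convergence, and for large \<open>v\<close> because the crude bound
  \<open>(2/y)^n\<close> is absorbed by extra powers of \<open>y v\<^sup>2\<close>. Gaussian moments turn this into an error
  \<open>C (B y)^(K+1) (K+1)!\<close> uniformly in \<open>K\<close>, from which both claims follow, the second with \<open>K\<close> about \<open>\<kappa>/y\<close>.
\<close>

subsection \<open>Pairs of finite sets of given charge\<close>

text \<open>Here \<open>x\<close> is the square root of the nome \<open>q\<close>, so that
  \<open>q^(n + 1/2)\<close> becomes the integral power \<open>x ^ (2 * n + 1)\<close> and the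
  weight is \<open>q\<close> to the \<open>L(0)\<close> eigenvalue.\<close>

definition pair_weight :: "real \<Rightarrow> nat set \<times> nat set \<Rightarrow> real" where
  "pair_weight x = (\<lambda>(N, M). (\<Prod>n\<in>N. x ^ (2 * n + 1)) * (\<Prod>m\<in>M. x ^ (2 * m + 1)))"

definition pairs_of_charge :: "int \<Rightarrow> nat set \<Rightarrow> nat set \<Rightarrow> (nat set \<times> nat set) set" where
  "pairs_of_charge c A B =
     {(N, M). finite N \<and> finite M \<and> N \<subseteq> A \<and> M \<subseteq> B \<and> int (card N) - int (card M) = c}"

definition charge_sum :: "real \<Rightarrow> int \<Rightarrow> nat set \<Rightarrow> nat set \<Rightarrow> real" where
  "charge_sum x c A B = infsum (pair_weight x) (pairs_of_charge c A B)"

lemma pair_weight_nonneg: "0 \<le> x \<Longrightarrow> 0 \<le> pair_weight x b"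
  by (auto simp: pair_weight_def split_beta intro!: mult_nonneg_nonneg prod_nonneg)

text \<open>A finite family of finite sets lies in the power set of its union; over that power set
  the products add up to a product of factors \<open>1 + f n\<close>, which is at most the
  exponential of the total sum.\<close>

lemma summable_on_finite_subsets_prod:
  fixes f :: "nat \<Rightarrow> real"
  assumes "summable f" and "\<And>n. 0 \<le> f n"
  shows "(\<lambda>N. \<Prod>n\<in>N. f n) summable_on {N. finite N}"
proof (rule nonneg_bdd_above_summable_on)
  show "0 \<le> prod f N" for N
    using assms(2) by (intro prod_nonneg) auto
  show "bdd_above (sum (prod f) ` {F. F \<subseteq> {N. finite N} \<and> finite F})"
  proof (rule bdd_aboveI2)
    fix F assume "F \<in> {F. F \<subseteq> {N :: nat set. finite N} \<and> finite F}"
    hence F: "finite F" "\<And>N. N \<in> F \<Longrightarrow> finite N" by auto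
    have fin: "finite (\<Union>F)" using F by blast
    have "sum (prod f) F \<le> sum (prod f) (Pow (\<Union>F))"
      using assms(2) fin by (intro sum_mono2) (auto intro!: prod_nonneg)
    also have "\<dots> = (\<Prod>n\<in>\<Union>F. 1 + f n)"
      using prod_add[OF fin, of f "\<lambda>_. 1"] by (simp add: add.commute)
    also have "\<dots> \<le> (\<Prod>n\<in>\<Union>F. exp (f n))"
      using assms(2) by (intro prod_mono) (auto simp: add_nonneg_nonneg)
    also have "\<dots> = exp (sum f (\<Union>F))" using fin by (simp add: exp_sum)
    also have "\<dots> \<le> exp (suminf f)"
      using sum_le_suminf[OF assms(1) fin] assms(2) by simp
    finally show "sum (prod f) F \<le> exp (suminf f)" .
  qed
qed

lemma pair_weight_summable_on:
  assumes "0 \<le> x" "x < 1"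
  shows "pair_weight x summable_on {(N, M). finite N \<and> finite M}"
proof -
  have "summable (\<lambda>n. x * (x\<^sup>2) ^ n)"
    using assms by (intro summable_mult summable_geometric) (auto simp: power_less_one_iff abs_square_less_1)
  hence "summable (\<lambda>n. x ^ (2 * n + 1))" by (simp add: power_mult)
  from summable_on_finite_subsets_prod[OF this] assms
  have S: "(\<lambda>N. \<Prod>n\<in>N. x ^ (2 * n + 1)) summable_on {N. finite N}" by simp
  have "pair_weight x summable_on {N. finite N} \<times> {N. finite N}"
  proof (rule summable_on_SigmaI)
    show "((\<lambda>M. pair_weight x (N, M)) has_sum (\<Prod>n\<in>N. x ^ (2 * n + 1)) *
            infsum (\<lambda>M. \<Prod>n\<in>M. x ^ (2 * n + 1)) {N. finite N}) {N. finite N}" for N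
      unfolding pair_weight_def by (simp add: has_sum_cmult_right has_sum_infsum[OF S, simplified])
    show "(\<lambda>N. (\<Prod>n\<in>N. x ^ (2 * n + 1)) *
            infsum (\<lambda>M. \<Prod>n\<in>M. x ^ (2 * n + 1)) {N. finite N}) summable_on {N. finite N}"
      by (rule summable_on_cmult_left[OF S])
  qed (use assms pair_weight_nonneg in auto)
  moreover have "{N :: nat set. finite N} \<times> {M :: nat set. finite M} = {(N, M). finite N \<and> finite M}" by auto
  ultimately show ?thesis by metis
qed

lemma pair_weight_summable_on_charge:
  "0 \<le> x \<Longrightarrow> x < 1 \<Longrightarrow> pair_weight x summable_on pairs_of_charge c A B"
  by (rule summable_on_subset_banach[OF pair_weight_summable_on]) (auto simp: pairs_of_charge_def)

lemma charge_sum_nonneg: "0 \<le> x \<Longrightarrow> 0 \<le> charge_sum x c A B"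
  unfolding charge_sum_def by (intro infsum_nonneg pair_weight_nonneg)

lemma charge_sum_bounded:
  assumes "0 \<le> x" "x < 1"
  shows "charge_sum x c A B \<le> infsum (pair_weight x) {(N, M). finite N \<and> finite M}"
  unfolding charge_sum_def
  using assms by (intro infsum_mono_neutral pair_weight_summable_on pair_weight_summable_on_charge)
    (auto simp: pairs_of_charge_def pair_weight_nonneg)

text \<open>Pairs are split by whether \<open>a\<close> belongs to \<open>N\<close>; deleting
  \<open>a\<close> lowers the charge by one and frees its weight. This recurrence drives both the
  triple product and, later, the removal of modes.\<close>

lemma charge_sum_insert_left:
  assumes x: "0 \<le> x" "x < 1" and a: "a \<notin> A"
  shows "charge_sum x c (insert a A) B
           = charge_sum x c A B + x ^ (2 * a + 1) * charge_sum x (c - 1) A B"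
proof -
  let ?g = "\<lambda>(N, M). (insert a N, M)"
  let ?I = "pairs_of_charge (c - 1) A B"
  have split: "pairs_of_charge c (insert a A) B = pairs_of_charge c A B \<union> ?g ` ?I"
  proof (intro equalityI subsetI)
    fix b assume b: "b \<in> pairs_of_charge c (insert a A) B"
    obtain N M where NM: "b = (N, M)" by (cases b)
    show "b \<in> pairs_of_charge c A B \<union> ?g ` ?I"
    proof (cases "a \<in> N")
      case True
      have "card N = Suc (card (N - {a}))"
        using b True card.remove[of N a] by (simp add: NM pairs_of_charge_def)
      hence "(N - {a}, M) \<in> ?I" "b = ?g (N - {a}, M)"
        using b True by (auto simp: NM pairs_of_charge_def)
      thus ?thesis by blast
    next
      case False
      thus ?thesis using b by (auto simp: NM pairs_of_charge_def)
    qed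
  next
    fix b assume "b \<in> pairs_of_charge c A B \<union> ?g ` ?I"
    thus "b \<in> pairs_of_charge c (insert a A) B"
    proof
      assume "b \<in> ?g ` ?I"
      then obtain N M where NM: "(N, M) \<in> ?I" "b = (insert a N, M)" by auto
      hence "a \<notin> N" using a by (auto simp: pairs_of_charge_def)
      thus ?thesis using NM by (auto simp: pairs_of_charge_def)
    qed (auto simp: pairs_of_charge_def)
  qed
  have disj: "pairs_of_charge c A B \<inter> ?g ` ?I = {}"
    using a by (auto simp: pairs_of_charge_def)
  have inj: "inj_on ?g ?I"
    using a by (auto simp: inj_on_def pairs_of_charge_def)
  have weight: "pair_weight x (?g b) = x ^ (2 * a + 1) * pair_weight x b" if b: "b \<in> ?I" for b
  proof -
    obtain N M where NM: "b = (N, M)" by (cases b)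
    have "a \<notin> N" "finite N" using b a by (auto simp: NM pairs_of_charge_def)
    thus ?thesis by (simp add: NM pair_weight_def)
  qed
  have "?g ` ?I \<subseteq> pairs_of_charge c (insert a A) B" using split by blast
  hence summ: "pair_weight x summable_on ?g ` ?I"
    using pair_weight_summable_on_charge[OF x] summable_on_subset_banach by blast
  have "charge_sum x c (insert a A) B = charge_sum x c A B + infsum (pair_weight x) (?g ` ?I)"
    unfolding charge_sum_def split
    by (rule infsum_Un_disjoint[OF pair_weight_summable_on_charge[OF x] summ disj])
  also have "infsum (pair_weight x) (?g ` ?I) = infsum (\<lambda>b. x ^ (2 * a + 1) * pair_weight x b) ?I"
    by (subst infsum_reindex[OF inj]) (intro infsum_cong, unfold o_def, rule weight)
  also have "\<dots> = x ^ (2 * a + 1) * charge_sum x (c - 1) A B"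
    unfolding charge_sum_def by (rule infsum_cmult_right')
  finally show ?thesis .
qed

text \<open>Exchanging \<open>N\<close> and \<open>M\<close> keeps the weight and reverses the
  charge, so the insertion rule carries over to the right set.\<close>

lemma charge_sum_swap: "charge_sum x c A B = charge_sum x (- c) B A"
proof -
  have "pairs_of_charge c A B = prod.swap ` pairs_of_charge (- c) B A"
    by (auto simp: pairs_of_charge_def image_iff)
  hence "charge_sum x c A B = infsum (pair_weight x \<circ> prod.swap) (pairs_of_charge (- c) B A)"
    by (simp add: charge_sum_def infsum_reindex)
  also have "pair_weight x \<circ> prod.swap = pair_weight x"
    by (auto simp: pair_weight_def mult.commute)
  finally show ?thesis by (simp add: charge_sum_def)
qed

lemma charge_sum_insert_right:
  assumes x: "0 \<le> x" "x < 1" and b: "b \<notin> B"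
  shows "charge_sum x c A (insert b B)
           = charge_sum x c A B + x ^ (2 * b + 1) * charge_sum x (c + 1) A B"
  using charge_sum_insert_left[OF x b, of "- c" A]
  by (simp add: charge_sum_swap[of x c] charge_sum_swap[of x "c + 1"])

section \<open>The Jacobi triple product, first finite, then infinite\<close>

definition qpoch :: "real \<Rightarrow> nat \<Rightarrow> real" where
  "qpoch q k = (\<Prod>i<k. 1 - q ^ Suc i)"

text \<open>The reciprocal of \<open>(q;q)_k\<close>, extended by 0 to negative \<open>k\<close> so
  that its recurrence holds at all integers and charges out of range need no case
  distinction.\<close>

definition inv_qpoch :: "real \<Rightarrow> int \<Rightarrow> real" where
  "inv_qpoch q k = (if k < 0 then 0 else 1 / qpoch q (nat k))"

lemma power_Suc_less_1: "0 \<le> q \<Longrightarrow> q < 1 \<Longrightarrow> q ^ Suc i < (1 :: real)"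
  by (cases "q = 0") (auto intro: power_Suc_less_one simp del: power_Suc)

lemma qpoch_pos: "0 \<le> q \<Longrightarrow> q < 1 \<Longrightarrow> 0 < qpoch q k"
  unfolding qpoch_def by (intro prod_pos ballI) (simp add: power_Suc_less_1 del: power_Suc)

lemma inv_qpoch_minus_one:
  assumes "0 < q" "q < 1"
  shows "inv_qpoch q (k - 1) = (1 - q powi k) * inv_qpoch q k"
proof (cases "k > 0")
  case True
  define j where "j = nat (k - 1)"
  have k: "k = int (Suc j)" using True by (simp add: j_def)
  have "1 - q ^ Suc j > 0"
    using assms by (auto simp: power_Suc_less_one simp del: power_Suc)
  moreover have "qpoch q j > 0" using qpoch_pos assms by auto
  moreover have "qpoch q (Suc j) = qpoch q j * (1 - q ^ Suc j)"
    by (simp add: qpoch_def)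
  moreover have "q powi k = q ^ Suc j" unfolding k by (rule power_int_of_nat)
  moreover have "inv_qpoch q k = 1 / qpoch q (Suc j)" "inv_qpoch q (k - 1) = 1 / qpoch q j"
    unfolding inv_qpoch_def k by (simp_all add: nat_add_distrib)
  ultimately show ?thesis by (simp del: power_Suc)
next
  case False
  \<comment> \<open>At \<open>k = 0\<close> the left side is 0 by convention and the right side
    contains \<open>1 - q powi 0 = 0\<close>.\<close>
  thus ?thesis by (cases "k = 0") (auto simp: inv_qpoch_def)
qed

lemma charge_sum_empty: "charge_sum x c {} {} = (if c = 0 then 1 else 0)"
proof -
  have "pairs_of_charge c {} {} = (if c = 0 then {({}, {})} else {})"
    by (auto simp: pairs_of_charge_def)
  thus ?thesis by (simp add: charge_sum_def pair_weight_def)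
qed

text \<open>Finite triple product: the right side is \<open>x powi (c * c)\<close> times the
  Gaussian binomial coefficient \<open>i + j\<close> over \<open>j + c\<close>. By the q-Pascal rule
  it obeys the same insertion recurrences as the left side.\<close>

lemma charge_sum_lessThan:
  assumes x: "0 < x" "x < 1"
  shows "charge_sum x c {..<i} {..<j}
    = x powi (c * c) * qpoch (x\<^sup>2) (i + j) * inv_qpoch (x\<^sup>2) (int j + c) * inv_qpoch (x\<^sup>2) (int i - c)"
proof -
  define q where "q = x\<^sup>2"
  have q: "0 < q" "q < 1" using x by (auto simp: q_def power_less_one_iff)
  have q_powi: "q powi k = x powi (2 * k)" for k
    by (simp add: q_def power_int_mult)
  have qp: "qpoch q (Suc k) = qpoch q k * (1 - q powi (int k + 1))" for k
    using power_int_of_nat[of q "Suc k"] by (simp add: qpoch_def add.commute)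
  note iq = inv_qpoch_minus_one[OF q]
  define V where "V c i j = x powi (c * c) * qpoch q (i + j) * inv_qpoch q (int j + c) * inv_qpoch q (int i - c)" for c i j
  have step_i: "V c (Suc i) j = V c i j + x ^ (2 * i + 1) * V (c - 1) i j" for c i j
  proof -
    have 1: "inv_qpoch q (int i - c) = (1 - q powi (int i + 1 - c)) * inv_qpoch q (int i + 1 - c)"
      using iq[of "int i + 1 - c"] by (simp add: algebra_simps)
    have 2: "inv_qpoch q (int j + (c - 1)) = (1 - q powi (int j + c)) * inv_qpoch q (int j + c)"
      using iq[of "int j + c"] by (simp add: algebra_simps)
    have "x ^ (2 * i + 1) * x powi ((c - 1) * (c - 1)) = x powi (2 * int i + 1 + (c - 1) * (c - 1))"
      using x power_int_of_nat[of x "2 * i + 1"] by (simp add: power_int_add)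
    also have "2 * int i + 1 + (c - 1) * (c - 1) = c * c + 2 * (int i + 1 - c)"
      by (simp add: algebra_simps)
    also have "x powi \<dots> = x powi (c * c) * q powi (int i + 1 - c)"
      using x by (subst power_int_add) (auto simp: q_powi)
    finally have 3: "x ^ (2 * i + 1) * x powi ((c - 1) * (c - 1)) = x powi (c * c) * q powi (int i + 1 - c)" .
    have 4: "q powi (int (i + j) + 1) = q powi (int i + 1 - c) * q powi (int j + c)"
      using q by (subst power_int_add[symmetric]) (auto simp: algebra_simps)
    have "V c i j + x ^ (2 * i + 1) * V (c - 1) i j
      = x powi (c * c) * qpoch q (i + j) * inv_qpoch q (int j + c) * inv_qpoch q (int i - c)
       + (x ^ (2 * i + 1) * x powi ((c - 1) * (c - 1))) * qpoch q (i + j) * inv_qpoch q (int j + (c - 1))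
          * inv_qpoch q (int i + 1 - c)"
      by (simp add: V_def algebra_simps)
    \<comment> \<open>The two terms combine by \<open>(1 - u) + u * (1 - v) = 1 - u * v\<close> with
      \<open>u = q powi (int i + 1 - c)\<close> and \<open>v = q powi (int j + c)\<close>.\<close>
    also have "\<dots> = x powi (c * c) * (qpoch q (i + j) * (1 - q powi (int (i + j) + 1)))
                     * inv_qpoch q (int j + c) * inv_qpoch q (int i + 1 - c)"
      unfolding 1 2 3 4 by (simp add: algebra_simps)
    also have "\<dots> = V c (Suc i) j"
      by (simp add: V_def qp algebra_simps)
    finally show ?thesis by simp
  qed
  have V_swap: "V c i j = V (- c) j i" for c i j
    by (simp add: V_def add.commute mult_ac)
  have step_j: "V c i (Suc j) = V c i j + x ^ (2 * j + 1) * V (c + 1) i j" for c i j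
    using step_i[of "- c" j i] V_swap[of c i "Suc j"] V_swap[of c i j] V_swap[of "c + 1" i j] by simp
  \<comment> \<open>The box is filled along \<open>i\<close> first and along \<open>j\<close>
    afterwards; \<open>c\<close> stays arbitrary because each insertion shifts the charge.\<close>
  have "charge_sum x c {..<i} {} = V c i 0" for c
  proof (induction i arbitrary: c)
    case 0
    show ?case by (auto simp: V_def charge_sum_empty inv_qpoch_def qpoch_def)
  next
    case (Suc i)
    show ?case
      using x Suc by (simp add: lessThan_Suc charge_sum_insert_left step_i del: power_Suc)
  qed
  hence "charge_sum x c {..<i} {..<j} = V c i j" for c
  proof (induction j arbitrary: c)
    case 0
    show ?case using 0 by simp
  next
    case (Suc j)
    show ?case
      using x Suc by (simp add: lessThan_Suc charge_sum_insert_right step_j del: power_Suc)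
  qed
  thus ?thesis unfolding V_def q_def .
qed

text \<open>Finitely many pairs use only finitely many modes, so the index sets of the boxes
  \<open>{..<L}\<close> eventually contain any given finite set of pairs, and the sums over them
  converge to the unconditional sum.\<close>

lemma charge_sum_lessThan_tendsto:
  assumes x: "0 \<le> x" "x < 1"
  shows "(\<lambda>L. charge_sum x c {..<L} {..<L}) \<longlonglongrightarrow> charge_sum x c UNIV UNIV"
proof -
  let ?I = "\<lambda>L. pairs_of_charge c {..<L} {..<L}"
  have fin: "finite (?I L)" for L
    by (rule finite_subset[of _ "Pow {..<L} \<times> Pow {..<L}"]) (auto simp: pairs_of_charge_def)
  have "\<forall>\<^sub>F L in sequentially. finite (?I L) \<and> X \<subseteq> ?I L \<and> ?I L \<subseteq> pairs_of_charge c UNIV UNIV"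
    if X: "finite X" "X \<subseteq> pairs_of_charge c UNIV UNIV" for X
  proof -
    define Y where "Y = (\<Union>(N, M)\<in>X. N \<union> M)"
    have "finite Y"
      using X by (auto simp: Y_def pairs_of_charge_def)
    then obtain L0 where L0: "\<And>n. n \<in> Y \<Longrightarrow> n < L0"
      by (meson finite_nat_set_iff_bounded)
    have "X \<subseteq> ?I L" if "L \<ge> L0" for L
    proof
      fix b assume b: "b \<in> X"
      obtain N M where NM: "b = (N, M)" by (cases b)
      have "N \<union> M \<subseteq> Y" using b by (auto simp: Y_def NM)
      hence "N \<subseteq> {..<L}" "M \<subseteq> {..<L}" using L0 that by force+
      thus "b \<in> ?I L" using b X by (auto simp: NM pairs_of_charge_def)
    qed
    thus ?thesis
      using fin by (intro eventually_sequentiallyI[of L0]) (auto simp: pairs_of_charge_def)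
  qed
  hence "filterlim ?I (finite_subsets_at_top (pairs_of_charge c UNIV UNIV)) sequentially"
    unfolding filterlim_finite_subsets_at_top by blast
  moreover have "(sum (pair_weight x) \<longlongrightarrow> charge_sum x c UNIV UNIV) (finite_subsets_at_top (pairs_of_charge c UNIV UNIV))"
    using has_sum_infsum[OF pair_weight_summable_on_charge[OF x]] unfolding has_sum_def charge_sum_def .
  ultimately have "(\<lambda>L. sum (pair_weight x) (?I L)) \<longlonglongrightarrow> charge_sum x c UNIV UNIV"
    by (rule filterlim_compose[rotated])
  thus ?thesis using fin by (simp add: charge_sum_def)
qed

lemma qpoch_tendsto:
  assumes q: "0 \<le> q" "q < 1"
  shows "qpoch q \<longlonglongrightarrow> (\<Prod>i. 1 - q ^ Suc i)" and "(\<Prod>i. 1 - q ^ Suc i) \<noteq> 0"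
proof -
  have "summable (\<lambda>i. q ^ Suc i)"
    using q by (subst summable_Suc_iff) (auto intro!: summable_geometric)
  hence "abs_convergent_prod (\<lambda>i. 1 - q ^ Suc i)"
    using q by (intro summable_imp_abs_convergent_prod) simp
  hence conv: "convergent_prod (\<lambda>i. 1 - q ^ Suc i)"
    by (rule abs_convergent_prod_imp_convergent_prod)
  have "(\<lambda>k. \<Prod>i\<le>k. 1 - q ^ Suc i) \<longlonglongrightarrow> (\<Prod>i. 1 - q ^ Suc i)"
    using convergent_prod_LIMSEQ[OF conv] .
  hence "(\<lambda>k. qpoch q (Suc k)) \<longlonglongrightarrow> (\<Prod>i. 1 - q ^ Suc i)"
    by (simp add: qpoch_def lessThan_Suc_atMost)
  thus "qpoch q \<longlonglongrightarrow> (\<Prod>i. 1 - q ^ Suc i)"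
    by (rule LIMSEQ_imp_Suc)
  have "1 - q ^ Suc i \<noteq> 0" for i
    using power_Suc_less_1[OF q, of i] by linarith
  thus "(\<Prod>i. 1 - q ^ Suc i) \<noteq> 0"
    using prodinf_nonzero[OF conv] by blast
qed

lemma inv_qpoch_tendsto:
  assumes q: "0 \<le> q" "q < 1"
  shows "(\<lambda>L. inv_qpoch q (int L + c)) \<longlonglongrightarrow> 1 / (\<Prod>i. 1 - q ^ Suc i)"
proof -
  have "filterlim (\<lambda>L. nat (int L + c)) at_top sequentially"
    unfolding filterlim_at_top
  proof
    fix Z
    show "\<forall>\<^sub>F L in sequentially. Z \<le> nat (int L + c)"
      using eventually_ge_at_top[of "Z + nat \<bar>c\<bar>"] by eventually_elim linarith
  qed
  hence "(\<lambda>L. 1 / qpoch q (nat (int L + c))) \<longlonglongrightarrow> 1 / (\<Prod>i. 1 - q ^ Suc i)"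
    by (intro tendsto_divide tendsto_const filterlim_compose[OF qpoch_tendsto(1)[OF q]] qpoch_tendsto(2)[OF q])
  moreover have "\<forall>\<^sub>F L in sequentially. 1 / qpoch q (nat (int L + c)) = inv_qpoch q (int L + c)"
    using eventually_ge_at_top[of "nat \<bar>c\<bar>"] by eventually_elim (auto simp: inv_qpoch_def)
  ultimately show ?thesis by (rule Lim_transform_eventually)
qed

text \<open>The Jacobi triple product, read off coefficientwise.\<close>

lemma charge_sum_UNIV:
  assumes x: "0 < x" "x < 1"
  shows "(\<Prod>i. 1 - (x\<^sup>2) ^ Suc i) * charge_sum x c UNIV UNIV = x powi (c * c)"
proof -
  let ?P = "\<Prod>i. 1 - (x\<^sup>2) ^ Suc i"
  have q: "0 \<le> x\<^sup>2" "x\<^sup>2 < 1" using x by (auto simp: power_less_one_iff)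
  note P = qpoch_tendsto[OF q]
  have "filterlim (\<lambda>L::nat. L + L) at_top sequentially"
    by (rule filterlim_at_top_mono[OF filterlim_ident]) auto
  hence P2: "(\<lambda>L. qpoch (x\<^sup>2) (L + L)) \<longlonglongrightarrow> ?P"
    by (rule filterlim_compose[OF P(1)])
  \<comment> \<open>One factor \<open>?P\<close> from the numerator meets two reciprocals, which
    leaves a single \<open>1 / ?P\<close>.\<close>
  have "(\<lambda>L. x powi (c * c) * qpoch (x\<^sup>2) (L + L) * inv_qpoch (x\<^sup>2) (int L + c) * inv_qpoch (x\<^sup>2) (int L + - c))
          \<longlonglongrightarrow> x powi (c * c) * ?P * (1 / ?P) * (1 / ?P)"
    by (intro tendsto_mult tendsto_const P2 inv_qpoch_tendsto q)
  moreover have "charge_sum x c {..<L} {..<L} = x powi (c * c) * qpoch (x\<^sup>2) (L + L)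
      * inv_qpoch (x\<^sup>2) (int L + c) * inv_qpoch (x\<^sup>2) (int L + - c)" for L
    using charge_sum_lessThan[OF x, of c L L] by simp
  ultimately have "(\<lambda>L. charge_sum x c {..<L} {..<L}) \<longlonglongrightarrow> x powi (c * c) * ?P * (1 / ?P) * (1 / ?P)"
    by simp
  from LIMSEQ_unique[OF this charge_sum_lessThan_tendsto] x
  have "charge_sum x c UNIV UNIV = x powi (c * c) * ?P * (1 / ?P) * (1 / ?P)" by simp
  thus ?thesis using P(2) by simp
qed

subsection \<open>Diagonal action on Fock space\<close>

lemma fold_in_kernel:
  assumes "\<And>n v. n \<in> set xs \<Longrightarrow> f v = 0 \<Longrightarrow> f (g n v) = (0 :: 'b :: zero)" and "f v = 0"
  shows "f (fold g xs v) = 0"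
  using assms by (induction xs arbitrary: v) auto

text \<open>The vector enters the kernel at the last occurrence of \<open>k\<close> in the list, and
  the operators applied afterwards preserve the kernel.\<close>

lemma fold_hits_kernel:
  assumes "\<And>n v. n \<in> set xs \<Longrightarrow> f v = 0 \<Longrightarrow> f (g n v) = (0 :: 'b :: zero)"
    and "k \<in> set xs" and "\<And>v. f (g k v) = 0"
  shows "f (fold g xs v) = 0"
  using assms
proof (induction xs arbitrary: v)
  case (Cons a xs)
  show ?case
  proof (cases "k \<in> set xs")
    case True
    thus ?thesis using Cons by auto
  next
    case False
    hence "a = k" using Cons.prems by auto
    hence "f (fold g xs (g a v)) = 0"
      using Cons.prems by - (rule fold_in_kernel, auto)
    thus ?thesis by simp
  qed
qed auto

text \<open>For \<open>k \<ge> 0\<close> the coefficient of index \<open>k\<close> annihilates and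
  then recreates the mode \<open>k\<close> of \<open>M\<close>. For \<open>k = - j - 1\<close> it
  creates first and annihilates afterwards, so it detects that \<open>j\<close> is absent from
  \<open>N\<close>.\<close>

definition mode_occupied :: "int \<Rightarrow> nat set \<times> nat set \<Rightarrow> bool" where
  "mode_occupied k = (\<lambda>(N, M). if k \<ge> 0 then nat k \<in> M else nat (- k - 1) \<notin> N)"

context fermionic_fock_space
begin

lemma psi_zero: "psi k 0 = 0" and psi_smul: "psi k (smul a v) = smul a (psi k v)"
proof -
  interpret P: Vector_Spaces.linear smul smul "psi k" by (rule linear_psi)
  show "psi k 0 = 0" "psi k (smul a v) = smul a (psi k v)" by (rule P.zero P.scale)+
qed

lemma psis_zero: "psis k 0 = 0" and psis_smul: "psis k (smul a v) = smul a (psis k v)"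
proof -
  interpret P: Vector_Spaces.linear smul smul "psis k" by (rule linear_psis)
  show "psis k 0 = 0" "psis k (smul a v) = smul a (psis k v)" by (rule P.zero P.scale)+
qed

text \<open>The anticommutator of a mode with itself only says that twice its square vanishes; the
  complex scalars allow division by 2.\<close>

lemma double_eq_zero: "(v :: 'f) + v = 0 \<Longrightarrow> v = 0"
proof -
  assume "v + v = 0"
  hence "smul 2 v = 0"
    using scale_left_distrib[of 1 1 v] by simp
  thus "v = 0" by simp
qed

lemma psi_psi_same: "psi k (psi k v) = 0" and psis_psis_same: "psis k (psis k v) = 0"
  by (rule double_eq_zero[OF anticomm_psi_psi] double_eq_zero[OF anticomm_psis_psis])+

lemma psi_psi_kernel: "psi k v = 0 \<Longrightarrow> psi k (psi l v) = 0"
  using anticomm_psi_psi[of k l v] by (simp add: psi_zero)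

lemma psis_psis_kernel: "psis k v = 0 \<Longrightarrow> psis k (psis l v) = 0"
  using anticomm_psis_psis[of k l v] by (simp add: psis_zero)

lemma psi_psis_kernel: "psi k v = 0 \<Longrightarrow> l + k + 1 \<noteq> 0 \<Longrightarrow> psi k (psis l v) = 0"
  using anticomm_psis_psi[of l k v] by (simp add: psis_zero)

lemma psis_psi_kernel: "psis l v = 0 \<Longrightarrow> l + k + 1 \<noteq> 0 \<Longrightarrow> psis l (psi k v) = 0"
  using anticomm_psis_psi[of l k v] by (simp add: psi_zero)

text \<open>The two operators in the coefficient have anticommutator 1, so a vector killed by
  \<open>psis (- k - 1)\<close> is fixed and a vector killed by \<open>psi k\<close> goes to 0.
  Every monomial is of one of these kinds: the killing operator meets its own copy, whose square is
  0, or reaches the vacuum.\<close>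

lemma A_coeff_monomial:
  assumes "b \<in> fock_index"
  shows "A_coeff psi psis k (fock_monomial psi psis vac b)
           = (if mode_occupied k b then fock_monomial psi psis vac b else 0)"
proof -
  obtain N M where b: "b = (N, M)" "finite N" "finite M"
    using assms by (auto simp: fock_index_def)
  define v where "v = fock_monomial psi psis vac b"
  have v: "v = fold (\<lambda>n. psi (- int n - 1)) (sorted_list_of_set N)
       (fold (\<lambda>m. psis (- int m - 1)) (sorted_list_of_set M) vac)"
    by (simp add: v_def fock_monomial_def b)
  have anti: "psis (- k - 1) (psi k v) + psi k (psis (- k - 1) v) = v"
    using anticomm_psis_psi[of "- k - 1" k v] by simp
  show ?thesis
  proof (cases "k \<ge> 0")
    case k: True
    then obtain j where j: "k = int j" by (metis nonneg_int_cases)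
    show ?thesis
    proof (cases "j \<in> M")
      case True
      have "psis (- k - 1) v = 0"
        unfolding v
      proof (rule fold_in_kernel)
        show "psis (- k - 1) (fold (\<lambda>m. psis (- int m - 1)) (sorted_list_of_set M) vac) = 0"
          by (rule fold_hits_kernel[where k = j])
            (use True b in \<open>auto simp: j psis_psis_same intro: psis_psis_kernel\<close>)
      qed (auto intro!: psis_psi_kernel simp: j)
      hence "A_coeff psi psis k v = v"
        using anti by (simp add: A_coeff_def psi_zero)
      thus ?thesis using True by (simp add: v_def b j mode_occupied_def)
    next
      case False
      have "psi k v = 0"
        unfolding v
      proof (rule fold_in_kernel)
        show "psi k (fold (\<lambda>m. psis (- int m - 1)) (sorted_list_of_set M) vac) = 0"
          by (rule fold_in_kernel) (use False b k in \<open>auto intro!: psi_psis_kernel psi_vac simp: j\<close>)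
      qed (auto intro!: psi_psi_kernel)
      hence "A_coeff psi psis k v = 0"
        by (simp add: A_coeff_def psis_zero)
      thus ?thesis using False by (simp add: v_def b j mode_occupied_def)
    qed
  next
    case k: False
    define j where "j = nat (- k - 1)"
    have j: "k = - int j - 1" using k by (simp add: j_def)
    show ?thesis
    proof (cases "j \<in> N")
      case True
      have "psi k v = 0"
        unfolding v
        by (rule fold_hits_kernel[where k = j])
          (use True b in \<open>auto simp: j psi_psi_same intro: psi_psi_kernel\<close>)
      hence "A_coeff psi psis k v = 0"
        by (simp add: A_coeff_def psis_zero)
      thus ?thesis using True by (simp add: v_def b j mode_occupied_def)
    next
      case False
      have "psis (- k - 1) v = 0"
        unfolding v
      proof (rule fold_in_kernel)
        show "psis (- k - 1) (fold (\<lambda>m. psis (- int m - 1)) (sorted_list_of_set M) vac) = 0"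
          by (rule fold_in_kernel) (auto intro!: psis_psis_kernel psis_vac simp: j)
      qed (use False b in \<open>auto intro!: psis_psi_kernel simp: j\<close>)
      hence "A_coeff psi psis k v = v"
        using anti by (simp add: A_coeff_def psi_zero)
      thus ?thesis using False by (simp add: v_def b j mode_occupied_def)
    qed
  qed
qed

lemma A_coeff_smul: "A_coeff psi psis k (smul a v) = smul a (A_coeff psi psis k v)"
  by (simp add: A_coeff_def psi_smul psis_smul)

lemma A_coeffs_monomial:
  assumes "b \<in> fock_index"
  shows "foldr (\<lambda>k X. A_coeff psi psis k \<circ> X) ks id (smul a (fock_monomial psi psis vac b))
           = (if \<forall>k\<in>set ks. mode_occupied k b then smul a (fock_monomial psi psis vac b) else 0)"
proof (induction ks)
  case (Cons k ks)
  have "A_coeff psi psis k 0 = 0" by (simp add: A_coeff_def psi_zero psis_zero)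
  thus ?case using Cons by (simp add: A_coeff_smul A_coeff_monomial[OF assms])
qed auto

text \<open>The product is diagonal with eigenvalues 0 and 1, so only the monomials that satisfy all
  mode conditions contribute to the trace.\<close>

lemma trace_F0_A_coeffs:
  "trace_F0 smul psi psis vac (foldr (\<lambda>k X. A_coeff psi psis k \<circ> X) ks id) \<tau>
     = (\<Sum>\<^sub>\<infinity>b\<in>{b \<in> fock_index. fock_charge b = 0 \<and> (\<forall>k\<in>set ks. mode_occupied k b)}.
          exp (2 * pi * \<i> * \<tau> * (of_real (L0_eigenvalue b) - 1/24)))"
  unfolding trace_F0_def
proof (rule infsum_cong_neutral, goal_cases)
  case (1 b)
  thus ?case by auto
next
  case (2 b)
  hence "\<not> (\<forall>k\<in>set ks. mode_occupied k b)" "b \<in> fock_index" by auto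
  thus ?case by (simp only: A_coeffs_monomial if_False representation_zero)
next
  case (3 b)
  hence b: "\<forall>k\<in>set ks. mode_occupied k b" "b \<in> fock_index" by auto
  hence "fock_monomial psi psis vac b \<in> fock_monomial psi psis vac ` fock_index" by auto
  thus ?case using b independent_monomials
    by (simp add: A_coeffs_monomial representation_scale representation_basis span_base)
qed

end

section \<open>Specialisation to \<open>\<tau> = \<i> * y\<close>: \<open>G\<close> as a restricted
  charge sum\<close>

lemma prodinf_of_real:
  assumes "convergent_prod f"
  shows "(\<Prod>i. complex_of_real (f i)) = of_real (\<Prod>i. f i)"
proof (rule LIMSEQ_unique)
  have "convergent_prod (\<lambda>i. complex_of_real (f i))"
    using assms convergent_prod_of_real_iff[of f] by (simp add: o_def)
  thus "(\<lambda>k. \<Prod>i\<le>k. complex_of_real (f i)) \<longlonglongrightarrow> (\<Prod>i. complex_of_real (f i))"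
    by (rule convergent_prod_LIMSEQ)
  show "(\<lambda>k. \<Prod>i\<le>k. complex_of_real (f i)) \<longlonglongrightarrow> of_real (\<Prod>i. f i)"
    using tendsto_of_real[OF convergent_prod_LIMSEQ[OF assms], where 'a = complex] by simp
qed

lemma dedekind_eta_imaginary:
  assumes "y > 0"
  shows "dedekind_eta (\<i> * of_real y)
    = of_real (exp (- pi * y / 12) * (\<Prod>i. 1 - ((exp (- pi * y))\<^sup>2) ^ Suc i))"
proof -
  have q: "0 \<le> (exp (- pi * y))\<^sup>2" "(exp (- pi * y))\<^sup>2 < 1"
    using assms by (auto simp: power_less_one_iff)
  have "summable (\<lambda>i. ((exp (- pi * y))\<^sup>2) ^ Suc i)"
    using q by (subst summable_Suc_iff) (auto intro!: summable_geometric)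
  hence "convergent_prod (\<lambda>i. 1 - ((exp (- pi * y))\<^sup>2) ^ Suc i)"
    using q by (intro abs_convergent_prod_imp_convergent_prod summable_imp_abs_convergent_prod) simp
  hence "of_real (\<Prod>i. 1 - ((exp (- pi * y))\<^sup>2) ^ Suc i)
      = (\<Prod>i. complex_of_real (1 - ((exp (- pi * y))\<^sup>2) ^ Suc i))"
    by (rule prodinf_of_real[symmetric])
  also have "(\<lambda>i. complex_of_real (1 - ((exp (- pi * y))\<^sup>2) ^ Suc i))
      = (\<lambda>m. 1 - exp (2 * pi * \<i> * (\<i> * of_real y) * of_nat (Suc m)))"
  proof
    fix m
    have "((exp (- pi * y))\<^sup>2) ^ Suc m = exp (- (2 * pi * y * real (Suc m)))"
      by (simp only: power_mult[symmetric] exp_of_nat_mult[symmetric]) (simp add: algebra_simps)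
    moreover have "2 * pi * \<i> * (\<i> * of_real y) * of_nat (Suc m) = of_real (- (2 * pi * y * real (Suc m)))"
      by (simp add: algebra_simps)
    ultimately show "complex_of_real (1 - ((exp (- pi * y))\<^sup>2) ^ Suc m)
        = 1 - exp (2 * pi * \<i> * (\<i> * of_real y) * of_nat (Suc m))"
      by (simp only: exp_of_real of_real_diff of_real_1)
  qed
  finally show ?thesis
    by (simp add: dedekind_eta_def exp_of_real[symmetric] algebra_simps)
qed

lemma pair_weight_exp:
  assumes "finite N" "finite M"
  shows "pair_weight (exp (- pi * y)) (N, M) = exp (- 2 * pi * y * L0_eigenvalue (N, M))"
proof -
  have "exp (- pi * y) ^ (2 * n + 1) = exp (- 2 * pi * y * (real n + 1/2))" for n
    by (simp add: exp_of_nat_mult[symmetric] algebra_simps del: power_Suc)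
  hence "pair_weight (exp (- pi * y)) (N, M)
     = (\<Prod>n\<in>N. exp (- 2 * pi * y * (real n + 1/2))) * (\<Prod>n\<in>M. exp (- 2 * pi * y * (real n + 1/2)))"
    by (simp add: pair_weight_def)
  also have "\<dots> = exp (- 2 * pi * y * L0_eigenvalue (N, M))"
    using assms by (simp only: exp_sum[symmetric] exp_add[symmetric] L0_eigenvalue_def prod.case
        distrib_left sum_distrib_left)
  finally show ?thesis .
qed

text \<open>Deleting the prescribed set \<open>R\<close> from \<open>M\<close> is a bijection from
  the surviving monomials of charge 0 onto the pairs of charge \<open>m\<close> that avoid
  \<open>S\<close> and \<open>R\<close>. The deleted modes become the prefactor; injectivity of
  \<open>r\<close> gives \<open>card R = m\<close>.\<close>

lemma G_coeff_eq_charge_sum: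
  fixes smul :: "complex \<Rightarrow> 'f::ab_group_add \<Rightarrow> 'f"
  assumes fock: "fermionic_fock_space smul psi psis vac"
    and m: "m \<le> n" and inj: "inj_on r {1..m}" and y: "y > 0"
  defines "x \<equiv> exp (- pi * y)"
  shows "G_coeff smul psi psis vac n m r s (\<i> * of_real y)
    = of_real ((\<Prod>j=1..m. x ^ (2 * r j + 1))
        * ((\<Prod>i. 1 - (x\<^sup>2) ^ Suc i) * charge_sum x (int m) (- (s ` {m+1..n})) (- (r ` {1..m}))))"
proof -
  interpret fermionic_fock_space smul psi psis vac by (rule fock)
  define R where "R = r ` {1..m}"
  define S where "S = s ` {m+1..n}"
  define ks where "ks = map (\<lambda>j. if j \<le> m then int (r j) else - int (s j) - 1) [1..<Suc n]"
  have cR: "card R = m" "finite R" using inj by (auto simp: R_def card_image)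
  have occ: "(\<forall>k\<in>set ks. mode_occupied k (N, M)) \<longleftrightarrow> R \<subseteq> M \<and> N \<subseteq> - S" for N M
  proof -
    have "set ks = (\<lambda>j. if j \<le> m then int (r j) else - int (s j) - 1) ` ({1..m} \<union> {m+1..n})"
      using m by (auto simp: ks_def)
    also have "\<dots> = (\<lambda>j. int (r j)) ` {1..m} \<union> (\<lambda>j. - int (s j) - 1) ` {m+1..n}"
      unfolding image_Un by (intro arg_cong2[of _ _ _ _ "(\<union>)"] image_cong) auto
    finally have ks: "set ks = (\<lambda>j. int (r j)) ` {1..m} \<union> (\<lambda>j. - int (s j) - 1) ` {m+1..n}" .
    show ?thesis unfolding ks R_def S_def ball_Un by (auto simp: mode_occupied_def)
  qed
  let ?J = "{b \<in> fock_index. fock_charge b = 0 \<and> (\<forall>k\<in>set ks. mode_occupied k b)}"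
  let ?I = "pairs_of_charge (int m) (- S) (- R)"
  let ?g = "\<lambda>(N, M). (N, M \<union> R)"
  have J: "?J = ?g ` ?I"
  proof (intro equalityI subsetI)
    fix b assume b: "b \<in> ?J"
    obtain N M where NM: "b = (N, M)" by (cases b)
    have *: "finite N" "finite M" "card N = card M" "R \<subseteq> M" "N \<subseteq> - S"
      using b occ[of N M] by (auto simp: NM fock_index_def fock_charge_def)
    hence "card M = card (M - R) + m"
      using cR card_Diff_subset[of R M] card_mono[of M R] by auto
    hence "(N, M - R) \<in> ?I" "b = ?g (N, M - R)"
      using * by (auto simp: pairs_of_charge_def NM)
    thus "b \<in> ?g ` ?I" by blast
  next
    fix b assume "b \<in> ?g ` ?I"
    then obtain N M where NM: "b = (N, M \<union> R)" "(N, M) \<in> ?I" by auto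
    hence *: "finite N" "finite M" "N \<subseteq> - S" "M \<inter> R = {}" "int (card N) - int (card M) = int m"
      by (auto simp: pairs_of_charge_def)
    hence "card (M \<union> R) = card M + m" using cR by (simp add: card_Un_disjoint)
    thus "b \<in> ?J" using * occ[of N "M \<union> R"] cR by (auto simp: NM fock_index_def fock_charge_def)
  qed
  have inj_g: "inj_on ?g ?I"
    by (auto simp: inj_on_def pairs_of_charge_def)
  have weight: "exp (2 * pi * \<i> * (\<i> * of_real y) * (of_real (L0_eigenvalue (?g b)) - 1/24))
      = of_real (exp (pi * y / 12) * (\<Prod>j=1..m. x ^ (2 * r j + 1))) * of_real (pair_weight x b)" (is "?l = ?r")
    if "b \<in> ?I" for b
  proof -
    obtain N M where b: "b = (N, M)" by (cases b)
    have *: "finite N" "finite M" "M \<inter> R = {}" using that by (auto simp: b pairs_of_charge_def)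
    have "(\<Prod>j=1..m. x ^ (2 * r j + 1)) = (\<Prod>k\<in>R. x ^ (2 * k + 1))"
      unfolding R_def by (simp add: prod.reindex[OF inj] del: One_nat_def)
    hence "(\<Prod>j=1..m. x ^ (2 * r j + 1)) * pair_weight x b = pair_weight x (?g b)"
      using * cR by (simp add: b pair_weight_def prod.union_disjoint mult_ac)
    also have "\<dots> = exp (- 2 * pi * y * L0_eigenvalue (?g b))"
      unfolding b x_def prod.case by (rule pair_weight_exp) (use * cR in auto)
    finally have "?r = of_real (exp (pi * y / 12) * exp (- 2 * pi * y * L0_eigenvalue (?g b)))"
      by (simp only: mult.assoc of_real_mult[symmetric])
    also have "\<dots> = exp (of_real (pi * y / 12 + - 2 * pi * y * L0_eigenvalue (?g b)))"
      by (simp only: exp_add[symmetric] exp_of_real)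
    also have "of_real (pi * y / 12 + - 2 * pi * y * L0_eigenvalue (?g b))
        = 2 * pi * \<i> * (\<i> * of_real y) * (of_real (L0_eigenvalue (?g b)) - 1/24)"
      by (simp add: algebra_simps)
    finally show ?thesis by simp
  qed
  have "pair_weight x summable_on ?I"
    using y by (intro pair_weight_summable_on_charge) (auto simp: x_def)
  hence of_real_sum: "((\<lambda>b. complex_of_real (pair_weight x b)) has_sum of_real (infsum (pair_weight x) ?I)) ?I"
    unfolding has_sum_of_real_iff by (rule has_sum_infsum)
  have "trace_F0 smul psi psis vac (foldr (\<lambda>k X. A_coeff psi psis k \<circ> X) ks id) (\<i> * of_real y)
     = (\<Sum>\<^sub>\<infinity>b\<in>?I. exp (2 * pi * \<i> * (\<i> * of_real y) * (of_real (L0_eigenvalue (?g b)) - 1/24)))"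
    unfolding trace_F0_A_coeffs J by (subst infsum_reindex[OF inj_g]) (simp add: o_def)
  also have "\<dots> = (\<Sum>\<^sub>\<infinity>b\<in>?I. of_real (exp (pi * y / 12) * (\<Prod>j=1..m. x ^ (2 * r j + 1))) * of_real (pair_weight x b))"
    by (rule infsum_cong) (rule weight)
  also have "\<dots> = of_real (exp (pi * y / 12) * (\<Prod>j=1..m. x ^ (2 * r j + 1))) * of_real (charge_sum x (int m) (- S) (- R))"
    unfolding charge_sum_def
    unfolding infsum_cmult_right' infsumI[OF of_real_sum] ..
  finally have tr: "trace_F0 smul psi psis vac (foldr (\<lambda>k X. A_coeff psi psis k \<circ> X) ks id) (\<i> * of_real y)
     = of_real (exp (pi * y / 12) * (\<Prod>j=1..m. x ^ (2 * r j + 1))) * of_real (charge_sum x (int m) (- S) (- R))" .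
  \<comment> \<open>The shift by \<open>1/24\<close> in the trace cancels the prefactor
    \<open>q^(1/24)\<close> of the eta function.\<close>
  have e: "exp (- pi * y / 12) * exp (pi * y / 12) = 1"
    by (simp flip: exp_add)
  have "G_coeff smul psi psis vac n m r s (\<i> * of_real y)
    = of_real (exp (- pi * y / 12) * (\<Prod>i. 1 - (x\<^sup>2) ^ Suc i)
       * (exp (pi * y / 12) * (\<Prod>j=1..m. x ^ (2 * r j + 1)) * charge_sum x (int m) (- S) (- R)))"
    unfolding G_coeff_def npoint_coeff_def ks_def[symmetric] tr dedekind_eta_imaginary[OF y] x_def[symmetric]
    by (simp only: of_real_mult)
  also have "\<dots> = of_real ((exp (- pi * y / 12) * exp (pi * y / 12)) * ((\<Prod>j=1..m. x ^ (2 * r j + 1))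
       * ((\<Prod>i. 1 - (x\<^sup>2) ^ Suc i) * charge_sum x (int m) (- S) (- R))))"
    by (simp only: mult_ac)
  finally show ?thesis unfolding e by (simp add: R_def S_def)
qed

subsection \<open>Gaussian integral representation\<close>

text \<open>With \<open>z = iexp (w * v)\<close> marking the charge, a mode of the left set
  contributes \<open>1 + z * x ^ (2 * s + 1)\<close> to the generating function, and one of the
  right set the same with \<open>1 / z\<close>. Excluded modes therefore enter as
  reciprocals.\<close>

definition fermi_kernel :: "real \<Rightarrow> real \<Rightarrow> nat set \<Rightarrow> nat set \<Rightarrow> real \<Rightarrow> complex" where
  "fermi_kernel x w S R v =
     (\<Prod>s\<in>S. 1 / (1 + iexp (w * v) * of_real (x ^ (2 * s + 1)))) *
     (\<Prod>r\<in>R. 1 / (1 + iexp (- (w * v)) * of_real (x ^ (2 * r + 1))))"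

lemma norm_one_plus_iexp_ge:
  assumes "0 \<le> t"
  shows "\<bar>1 - t\<bar> \<le> cmod (1 + iexp a * of_real t)"
proof -
  have "\<bar>cmod 1 - cmod (- (iexp a * of_real t))\<bar> \<le> cmod (1 - (- (iexp a * of_real t)))"
    by (rule norm_triangle_ineq3)
  thus ?thesis using assms by (simp add: norm_mult)
qed

lemma one_plus_iexp_nonzero:
  assumes "0 \<le> x" "x < 1"
  shows "1 + iexp a * of_real (x ^ (2 * k + 1)) \<noteq> 0"
  using norm_one_plus_iexp_ge[of "x ^ (2 * k + 1)" a] power_Suc_less_1[OF assms, of "2 * k"] assms
  by (auto simp del: power_Suc)

lemma fermi_kernel_bounded:
  assumes "0 \<le> x" "x < 1"
  obtains B where "\<And>v. cmod (fermi_kernel x w S R v) \<le> B"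
proof
  have *: "cmod (1 / (1 + iexp a * of_real (x ^ (2 * k + 1)))) \<le> 1 / (1 - x ^ (2 * k + 1))" for a k
  proof -
    have "1 - x ^ (2 * k + 1) > 0" using power_Suc_less_1[OF assms, of "2 * k"] by simp
    moreover have "1 - x ^ (2 * k + 1) \<le> cmod (1 + iexp a * of_real (x ^ (2 * k + 1)))"
      using norm_one_plus_iexp_ge[of "x ^ (2 * k + 1)" a] assms by auto
    ultimately show ?thesis by (simp add: norm_divide frac_le)
  qed
  have nn: "0 \<le> 1 / (1 - x ^ (2 * k + 1))" for k
    using power_Suc_less_1[OF assms, of "2 * k"] by simp
  show "cmod (fermi_kernel x w S R v)
      \<le> (\<Prod>s\<in>S. 1 / (1 - x ^ (2 * s + 1))) * (\<Prod>r\<in>R. 1 / (1 - x ^ (2 * r + 1)))" for v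
    unfolding fermi_kernel_def norm_mult prod_norm[symmetric]
    by (intro mult_mono prod_mono conjI * norm_ge_zero prod_nonneg nn)
qed

lemma fermi_kernel_measurable [measurable]: "fermi_kernel x w S R \<in> borel_measurable borel"
  unfolding fermi_kernel_def by measurable

lemma integrable_iexp_fermi_kernel:
  assumes "0 \<le> x" "x < 1"
  shows "integrable std_normal_distribution (\<lambda>v. iexp (c * v) * fermi_kernel x w S R v)"
proof -
  interpret real_distribution std_normal_distribution by (rule real_dist_normal_dist)
  obtain B where B: "\<And>v. cmod (fermi_kernel x w S R v) \<le> B"
    using fermi_kernel_bounded[OF assms] by blast
  show ?thesis
    by (rule integrable_const_bound[where B = B]) (auto simp: norm_mult B)
qed

text \<open>Since the recurrence holds at every integer it can be iterated forever, and boundedness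
  makes \<open>t ^ k * D (c + k * e)\<close> tend to 0.\<close>

lemma bounded_geometric_recurrence_zero:
  fixes D :: "int \<Rightarrow> complex"
  assumes rec: "\<And>c. D c = t * D (c + e)" and t: "cmod t < 1" and bd: "\<And>c. cmod (D c) \<le> B"
  shows "D c = 0"
proof -
  have "cmod (D c) \<le> cmod t ^ k * B" for k
  proof -
    have "D c = t ^ k * D (c + int k * e)"
    proof (induction k)
      case (Suc k)
      thus ?case using rec[of "c + int k * e"] by (simp add: algebra_simps)
    qed simp
    thus ?thesis using bd by (simp add: norm_mult norm_power mult_left_mono)
  qed
  moreover have "(\<lambda>k. cmod t ^ k * B) \<longlonglongrightarrow> 0 * B"
    using t by (intro tendsto_mult tendsto_const LIMSEQ_power_zero) simp
  ultimately have "cmod (D c) \<le> 0"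
    by (intro LIMSEQ_le_const) auto
  thus ?thesis by simp
qed

text \<open>Both sides satisfy the same two-term recurrence in the charge when a mode is removed,
  so their difference satisfies a homogeneous geometric recurrence over all integers; being bounded, it vanishes.\<close>

lemma charge_sum_eq_gaussian_integral:
  assumes y: "y > 0" and fin: "finite S" "finite R"
  defines "x \<equiv> exp (- pi * y)" and "w \<equiv> sqrt (2 * pi * y)"
  shows "of_real ((\<Prod>i. 1 - (x\<^sup>2) ^ Suc i) * charge_sum x c (- S) (- R))
    = (CLINT v|std_normal_distribution. iexp (- (of_int c * w) * v) * fermi_kernel x w S R v)"
proof -
  have x: "0 < x" "x < 1" "0 \<le> x" using y by (auto simp: x_def)
  define P where "P = (\<Prod>i. 1 - (x\<^sup>2) ^ Suc i)"
  define I where "I c S R = (CLINT v|std_normal_distribution. iexp (- (of_int c * w) * v) * fermi_kernel x w S R v)"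
    for c S R
  define D where "D S R c = of_real (P * charge_sum x c (- S) (- R)) - I c S R" for S R c
  interpret real_distribution std_normal_distribution by (rule real_dist_normal_dist)
  have intg: "integrable std_normal_distribution (\<lambda>v. iexp (- (of_int c * w) * v) * fermi_kernel x w S R v)" for c S R
    by (rule integrable_iexp_fermi_kernel) (use x in auto)
  have bounded: "\<exists>B. \<forall>c. cmod (D S R c) \<le> B" for S R
  proof -
    obtain B where B: "\<And>v. cmod (fermi_kernel x w S R v) \<le> B"
      using fermi_kernel_bounded[OF x(3,2)] by blast
    have I: "cmod (I c S R) \<le> B" for c
    proof -
      have "cmod (I c S R) \<le> (LINT v|std_normal_distribution. cmod (iexp (- (of_int c * w) * v) * fermi_kernel x w S R v))"
        unfolding I_def by (rule integral_norm_bound)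
      also have "\<dots> \<le> (LINT v|std_normal_distribution. B)"
        using x by (intro integral_mono integrable_norm intg integrable_const) (auto simp: norm_mult B)
      finally show ?thesis using prob_space by simp
    qed
    let ?T = "infsum (pair_weight x) {(N, M). finite N \<and> finite M}"
    have W: "cmod (of_real (P * charge_sum x c (- S) (- R))) \<le> \<bar>P\<bar> * ?T" for c
      using x charge_sum_bounded[of x c "- S" "- R"] charge_sum_nonneg[of x c "- S" "- R"]
      unfolding norm_of_real abs_mult by (intro mult_left_mono) auto
    have "cmod (D S R c) \<le> \<bar>P\<bar> * ?T + B" for c
      unfolding D_def using I[of c] W[of c] norm_triangle_ineq4 by (smt (verit))
    thus ?thesis by blast
  qed
  have t: "cmod (of_real (x ^ (2 * k + 1))) < 1" for k
    unfolding norm_of_real using power_Suc_less_1[of x "2 * k"] x by simp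
  have base: "D {} {} c = 0" for c
  proof -
    \<comment> \<open>With no mode excluded the integral is the Gaussian characteristic function at
      \<open>- c * w\<close>. As \<open>w\<^sup>2 = 2 * pi * y\<close>, its value is
      \<open>x powi (c * c)\<close>, in agreement with the triple product.\<close>
    have "I c {} {} = char std_normal_distribution (- (of_int c * w))"
      by (simp add: I_def char_def fermi_kernel_def)
    also have "\<dots> = of_real (exp (- ((of_int c * w)\<^sup>2) / 2))"
      by (simp add: char_std_normal_distribution)
    also have "(of_int c * w)\<^sup>2 / 2 = of_int (c * c) * (pi * y)"
      using y by (simp add: w_def power_mult_distrib power2_eq_square)
    hence "- ((of_int c * w)\<^sup>2) / 2 = of_int (c * c) * (- pi * y)"
      by (metis minus_divide_left mult_minus_left mult_minus_right)
    hence "exp (- ((of_int c * w)\<^sup>2) / 2) = x powi (c * c)"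
      unfolding x_def exp_power_int by (rule arg_cong)
    finally show ?thesis
      using charge_sum_UNIV[OF x(1,2), of c] by (simp add: D_def P_def)
  qed
  \<comment> \<open>Restoring a mode multiplies the kernel by a two-term factor whose phase shifts
    the charge by \<open>e\<close>: the insertion recurrence on the integral side, used with
    \<open>e = -1\<close> for \<open>S\<close> and \<open>e = 1\<close> for
    \<open>R\<close>.\<close>
  have split: "I c S R = I c S' R' + t * I (c + e) S' R'"
    if K: "\<And>v. fermi_kernel x w S R v = fermi_kernel x w S' R' v * (1 + iexp (- (of_int e * w) * v) * t)"
    for c e S R S' R' t
  proof -
    have "iexp (- (of_int c * w) * v) * fermi_kernel x w S R v
        = iexp (- (of_int c * w) * v) * fermi_kernel x w S' R' v
          + t * (iexp (- (of_int (c + e) * w) * v) * fermi_kernel x w S' R' v)" for v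
    proof -
      have "iexp (- (of_int (c + e) * w) * v) = iexp (- (of_int c * w) * v) * iexp (- (of_int e * w) * v)"
        by (simp add: exp_add[symmetric] algebra_simps)
      thus ?thesis unfolding K by (simp only: ring_distribs mult_ac mult_1_left mult_1_right)
    qed
    hence "I c S R = (CLINT v|std_normal_distribution. iexp (- (of_int c * w) * v) * fermi_kernel x w S' R' v
          + t * (iexp (- (of_int (c + e) * w) * v) * fermi_kernel x w S' R' v))"
      unfolding I_def by (intro Bochner_Integration.integral_cong refl)
    also have "\<dots> = I c S' R' + t * I (c + e) S' R'"
      unfolding I_def by (subst Bochner_Integration.integral_add[OF intg integrable_mult_right[OF intg]]) (rule arg_cong[OF integral_mult_right_zero])
    finally show ?thesis .
  qed
  have zero_S: "D S {} c = 0" for c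
    using fin(1)
  proof (induction S arbitrary: c rule: finite_induct)
    case (insert s S)
    let ?t = "complex_of_real (x ^ (2 * s + 1))"
    have "- S = insert s (- insert s S)" using insert by auto
    hence W: "charge_sum x c (- S) (- {}) = charge_sum x c (- insert s S) (- {})
        + x ^ (2 * s + 1) * charge_sum x (c + (- 1)) (- insert s S) (- {})" for c
      using charge_sum_insert_left[of x s "- insert s S" c "- {}"] x by simp
    have "fermi_kernel x w S {} v = fermi_kernel x w (insert s S) {} v * (1 + iexp (- (of_int (- 1) * w) * v) * ?t)" for v
      using one_plus_iexp_nonzero[of x "w * v" s] x insert
      by (simp add: fermi_kernel_def del: of_real_power power_Suc)
    from split[OF this] have "D S {} c = D (insert s S) {} c + ?t * D (insert s S) {} (c + (- 1))" for c
      unfolding D_def W by (simp add: algebra_simps)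
    \<comment> \<open>The induction hypothesis kills the left side, leaving a homogeneous recurrence
      for the larger excluded set.\<close>
    hence "D (insert s S) {} c = (- ?t) * D (insert s S) {} (c + (- 1))" for c
      using insert.IH[of c] by (simp add: add_eq_0_iff2)
    from bounded_geometric_recurrence_zero[of "D (insert s S) {}", OF this] t[of s] bounded[of "insert s S" "{}"]
    show ?case by (metis norm_minus_cancel)
  qed (use base in auto)
  have "D S R c = 0" for c
    using fin(2)
  proof (induction R arbitrary: c rule: finite_induct)
    case (insert s R)
    let ?t = "complex_of_real (x ^ (2 * s + 1))"
    have "- R = insert s (- insert s R)" using insert by auto
    hence W: "charge_sum x c (- S) (- R) = charge_sum x c (- S) (- insert s R)
        + x ^ (2 * s + 1) * charge_sum x (c + 1) (- S) (- insert s R)" for c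
      using charge_sum_insert_right[of x s "- insert s R" c "- S"] x by simp
    have "fermi_kernel x w S R v = fermi_kernel x w S (insert s R) v * (1 + iexp (- (of_int 1 * w) * v) * ?t)" for v
      using one_plus_iexp_nonzero[of x "- (w * v)" s] x insert
      by (simp add: fermi_kernel_def del: of_real_power power_Suc)
    from split[OF this] have "D S R c = D S (insert s R) c + ?t * D S (insert s R) (c + 1)" for c
      unfolding D_def W by (simp add: algebra_simps)
    hence "D S (insert s R) c = (- ?t) * D S (insert s R) (c + 1)" for c
      using insert.IH[of c] by (simp add: add_eq_0_iff2)
    from bounded_geometric_recurrence_zero[of "D S (insert s R)", OF this] t[of s] bounded[of S "insert s R"]
    show ?case by (metis norm_minus_cancel)
  qed (use zero_S in auto)
  thus ?thesis by (simp add: D_def I_def P_def)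
qed

subsection \<open>Multiple power series with weights\<close>

text \<open>The terms of the series at a point \<open>e\<close> inside the disc of convergence are
  bounded, which gives \<open>R = 1 / e\<close>. Choosing \<open>e\<close> also within the disc
  where the sum equals \<open>f\<close> lets one \<open>R\<close> serve both conclusions.\<close>

lemma has_fps_expansion_geometric_bound:
  fixes f :: "complex \<Rightarrow> complex"
  assumes "f has_fps_expansion F"
  obtains R C where "R > 0" "C > 0" "\<And>k. cmod (fps_nth F k) \<le> C * R ^ k"
    "\<And>w. cmod w * R < 1 \<Longrightarrow> (\<lambda>k. fps_nth F k * w ^ k) sums f w"
proof -
  have ev: "\<forall>\<^sub>F z in nhds 0. eval_fps F z = f z" and rad: "fps_conv_radius F > 0"
    using assms by (auto simp: has_fps_expansion_def)
  obtain d where d: "d > 0" "\<And>z. cmod z < d \<Longrightarrow> eval_fps F z = f z"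
    using ev by (auto simp: eventually_nhds_metric)
  obtain d' where d': "d' > 0" "ereal d' < fps_conv_radius F"
    using rad ereal_dense2[of 0 "fps_conv_radius F"] by (auto simp: zero_ereal_def)
  define e where "e = min d d'"
  have e: "e > 0" "ereal e < fps_conv_radius F" "e \<le> d"
    using d(1) d' le_less_trans[of "ereal e" "ereal d'"] by (auto simp: e_def)
  have "summable (\<lambda>k. fps_nth F k * of_real e ^ k)"
    using e by (intro summable_fps) auto
  hence "Bseq (\<lambda>k. fps_nth F k * of_real e ^ k)"
    by (intro convergent_imp_Bseq summable_LIMSEQ_zero[THEN convergentI])
  then obtain C where C: "C > 0" "\<And>k. cmod (fps_nth F k * of_real e ^ k) \<le> C"
    by (auto simp: Bseq_def)
  show ?thesis
  proof
    show "1 / e > 0" "C > 0" using e C by auto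
    show "cmod (fps_nth F k) \<le> C * (1 / e) ^ k" for k
      using C(2)[of k] e by (simp add: norm_mult norm_power power_divide field_simps)
    show "(\<lambda>k. fps_nth F k * w ^ k) sums f w" if "cmod w * (1 / e) < 1" for w
    proof -
      have w: "cmod w < e" using that e by (simp add: field_simps)
      have "ereal (cmod w) < fps_conv_radius F"
        using w e(2) by (meson ereal_less_eq(3) le_less_trans less_imp_le)
      hence "(\<lambda>k. fps_nth F k * w ^ k) sums eval_fps F w"
        unfolding eval_fps_def by (intro summable_sums summable_fps)
      thus ?thesis using d(2) w e by simp
    qed
  qed
qed

text \<open>This is \<open>E_k(x) / k!\<close>, kept without the factorial because it grows only
  geometrically.\<close>

definition euler_coeff :: "complex \<Rightarrow> nat \<Rightarrow> complex" where
  "euler_coeff x k = fps_nth (2 * fps_exp x / (fps_exp 1 + 1)) k"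

lemma euler_coeff_expansion:
  fixes x :: complex
  shows "(\<lambda>w. 2 * exp (x * w) / (exp w + 1)) has_fps_expansion (2 * fps_exp x / (fps_exp 1 + 1))"
proof -
  have "(\<lambda>w. 2 * exp (x * w) / (exp (1 * w) + 1)) has_fps_expansion (2 * fps_exp x / (fps_exp 1 + 1))"
    by (intro fps_expansion_intros) (auto simp: subdegree_eq_0)
  thus ?thesis by simp
qed

lemma euler_coeff_bound:
  obtains R C where "R > 0" "C > 0"
    "\<And>x k. x \<in> {0, 1} \<Longrightarrow> cmod (euler_coeff x k) \<le> C * R ^ k"
    "\<And>x w. x \<in> {0, 1} \<Longrightarrow> cmod w * R < 1 \<Longrightarrow> (\<lambda>k. euler_coeff x k * w ^ k) sums (2 * exp (x * w) / (exp w + 1))"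
proof -
  obtain R0 C0 where 0: "R0 > 0" "C0 > 0" "\<And>k. cmod (euler_coeff 0 k) \<le> C0 * R0 ^ k"
    "\<And>w. cmod w * R0 < 1 \<Longrightarrow> (\<lambda>k. euler_coeff 0 k * w ^ k) sums (2 * exp (0 * w) / (exp w + 1))"
    unfolding euler_coeff_def by (rule has_fps_expansion_geometric_bound[OF euler_coeff_expansion[of 0]]) blast
  obtain R1 C1 where 1: "R1 > 0" "C1 > 0" "\<And>k. cmod (euler_coeff 1 k) \<le> C1 * R1 ^ k"
    "\<And>w. cmod w * R1 < 1 \<Longrightarrow> (\<lambda>k. euler_coeff 1 k * w ^ k) sums (2 * exp (1 * w) / (exp w + 1))"
    unfolding euler_coeff_def by (rule has_fps_expansion_geometric_bound[OF euler_coeff_expansion[of 1]]) blast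
  let ?R = "max R0 R1" and ?C = "max C0 C1"
  show ?thesis
  proof
    show "?R > 0" "?C > 0" using 0(1,2) by auto
    have "C0 * R0 ^ k \<le> ?C * ?R ^ k" "C1 * R1 ^ k \<le> ?C * ?R ^ k" for k
      using 0(1,2) 1(1,2) by (intro mult_mono power_mono; simp)+
    thus "cmod (euler_coeff x k) \<le> ?C * ?R ^ k" if "x \<in> {0, 1}" for x k
      using that 0(3)[of k] 1(3)[of k] by (auto intro: order_trans)
    show "(\<lambda>k. euler_coeff x k * w ^ k) sums (2 * exp (x * w) / (exp w + 1))"
      if "x \<in> {0, 1}" "cmod w * ?R < 1" for x w
    proof -
      have "cmod w * R0 \<le> cmod w * ?R" "cmod w * R1 \<le> cmod w * ?R" by (auto intro: mult_left_mono)
      thus ?thesis using that 0(4)[of w] 1(4)[of w] by auto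
    qed
  qed
qed

section \<open>Double and multiple expansions graded by weight\<close>

definition exponent_pairs :: "(nat \<times> nat) set" where
  "exponent_pairs = {(\<nu>, l). l \<le> \<nu>}"

lemma exponent_pairs_Sigma: "exponent_pairs = Sigma UNIV (\<lambda>\<nu>. {..\<nu>})"
  by (auto simp: exponent_pairs_def)

text \<open>Summing norms over \<open>l\<close> first gives
  \<open>cmod (a \<nu>) * (cmod X + cmod Y) ^ \<nu>\<close>; hence the smallness condition on
  \<open>cmod X + cmod Y\<close> rather than on \<open>cmod (X + Y)\<close>.\<close>

lemma binomial_expansion_abs_summable:
  fixes a :: "nat \<Rightarrow> complex"
  assumes a: "\<And>k. cmod (a k) \<le> C * R ^ k" and R: "R \<ge> 0" and XY: "(cmod X + cmod Y) * R < 1"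
    and f: "(\<lambda>k. a k * (X + Y) ^ k) sums s"
  shows "(\<lambda>b. norm ((\<lambda>(\<nu>, l). a \<nu> * of_nat (\<nu> choose l) * X ^ l * Y ^ (\<nu> - l)) b)) summable_on exponent_pairs"
    and "infsum (\<lambda>(\<nu>, l). a \<nu> * of_nat (\<nu> choose l) * X ^ l * Y ^ (\<nu> - l)) exponent_pairs = s"
proof -
  let ?t = "\<lambda>(\<nu>, l). a \<nu> * of_nat (\<nu> choose l) * X ^ l * Y ^ (\<nu> - l)"
  have norm_sum: "(\<Sum>l\<le>\<nu>. cmod (?t (\<nu>, l))) = cmod (a \<nu>) * (cmod X + cmod Y) ^ \<nu>" for \<nu>
    unfolding binomial_ring sum_distrib_left by (simp add: norm_mult norm_power mult_ac)
  have "summable (\<lambda>\<nu>. cmod (a \<nu>) * (cmod X + cmod Y) ^ \<nu>)"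
  proof (rule summable_comparison_test')
    show "summable (\<lambda>\<nu>. C * ((cmod X + cmod Y) * R) ^ \<nu>)"
      using XY R by (intro summable_mult summable_geometric) auto
    show "norm (cmod (a \<nu>) * (cmod X + cmod Y) ^ \<nu>) \<le> C * ((cmod X + cmod Y) * R) ^ \<nu>" for \<nu>
      using mult_right_mono[OF a[of \<nu>], of "(cmod X + cmod Y) ^ \<nu>"]
      by (simp add: power_mult_distrib mult_ac abs_mult)
  qed
  hence "(\<lambda>\<nu>. cmod (a \<nu>) * (cmod X + cmod Y) ^ \<nu>) summable_on UNIV"
    by (subst summable_on_UNIV_nonneg_real_iff) auto
  thus summ: "(\<lambda>b. norm (?t b)) summable_on exponent_pairs"
    unfolding exponent_pairs_Sigma Infinite_Sum.abs_summable_on_Sigma_iff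
    by (auto simp: norm_sum[simplified] abs_mult intro!: summable_on_cong[THEN iffD1])
  have "infsum ?t exponent_pairs = (\<Sum>\<^sub>\<infinity>\<nu>. \<Sum>\<^sub>\<infinity>l\<in>{..\<nu>}. ?t (\<nu>, l))"
    using abs_summable_summable[OF summ] unfolding exponent_pairs_Sigma
    by (rule infsum_Sigma_banach[symmetric])
  also have "\<dots> = (\<Sum>\<^sub>\<infinity>\<nu>. a \<nu> * (X + Y) ^ \<nu>)"
    by (simp add: binomial_ring sum_distrib_left mult_ac)
  also have "\<dots> = s"
  proof (rule infsumI, rule norm_summable_imp_has_sum[OF _ f])
    show "summable (\<lambda>k. norm (a k * (X + Y) ^ k))"
    proof (rule summable_comparison_test')
      show "summable (\<lambda>\<nu>. cmod (a \<nu>) * (cmod X + cmod Y) ^ \<nu>)" by fact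
      show "norm (norm (a k * (X + Y) ^ k)) \<le> cmod (a k) * (cmod X + cmod Y) ^ k" for k
        by (auto simp: norm_mult norm_power intro!: mult_left_mono power_mono norm_triangle_ineq)
    qed
  qed
  finally show "infsum ?t exponent_pairs = s" .
qed

text \<open>A pair \<open>(\<nu>, l)\<close> stands for \<open>l\<close> factors of order
  \<open>sqrt y\<close> and \<open>\<nu> - l\<close> factors of order \<open>y\<close>, so
  \<open>2 * \<nu> - l\<close> is the order in \<open>sqrt y\<close>.\<close>

definition multi_weight :: "'a set \<Rightarrow> ('a \<Rightarrow> nat \<times> nat) \<Rightarrow> nat" where
  "multi_weight A g = (\<Sum>j\<in>A. 2 * fst (g j) - snd (g j))"

abbreviation multi_exponents :: "'a set \<Rightarrow> ('a \<Rightarrow> nat \<times> nat) set" where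
  "multi_exponents A \<equiv> PiE A (\<lambda>_. exponent_pairs)"

text \<open>For fixed \<open>\<nu>\<close> there are \<open>Suc \<nu> \<le> 2 ^ \<nu>\<close> terms,
  each at most \<open>(1/4) ^ \<nu>\<close>, so the base \<open>1/4\<close> still leaves a geometric
  series of ratio \<open>1/2\<close>.\<close>

lemma quarter_weight_summable:
  "(\<lambda>b. norm ((\<lambda>(\<nu>, l). (1/4 :: real) ^ (2 * \<nu> - l)) b)) summable_on exponent_pairs"
proof -
  have "summable (\<lambda>\<nu>. (1/2 :: real) ^ \<nu>)" by (intro summable_geometric) auto
  hence half: "(\<lambda>\<nu>. (1/2 :: real) ^ \<nu>) summable_on UNIV"
    by (subst summable_on_UNIV_nonneg_real_iff) auto
  have "(\<Sum>l\<le>\<nu>. (1/4 :: real) ^ (2 * \<nu> - l)) \<le> (1/2) ^ \<nu>" for \<nu>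
  proof -
    have "(\<Sum>l\<le>\<nu>. (1/4 :: real) ^ (2 * \<nu> - l)) \<le> (\<Sum>l\<le>\<nu>. (1/4) ^ \<nu>)"
      by (intro sum_mono power_decreasing) auto
    also have "\<dots> = real (Suc \<nu>) * (1/4) ^ \<nu>" by simp
    also have "\<dots> \<le> 2 ^ \<nu> * (1/4) ^ \<nu>"
      using less_exp[of \<nu>] by (intro mult_right_mono) (auto simp: Suc_le_eq simp flip: of_nat_Suc)
    also have "\<dots> = (1/2) ^ \<nu>" by (simp flip: power_mult_distrib)
    finally show ?thesis .
  qed
  hence "(\<lambda>\<nu>. \<Sum>l\<le>\<nu>. (1/4 :: real) ^ (2 * \<nu> - l)) summable_on UNIV"
    by (intro summable_on_comparison_test[OF half]) (auto intro!: sum_nonneg)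
  thus ?thesis
    unfolding exponent_pairs_Sigma Infinite_Sum.abs_summable_on_Sigma_iff by (auto simp: sum_nonneg)
qed

definition quarter_mass :: real where
  "quarter_mass = infsum (\<lambda>(\<nu>, l). (1/4 :: real) ^ (2 * \<nu> - l)) exponent_pairs"

lemma quarter_mass_pos: "quarter_mass > 0"
proof -
  have "(\<Sum>(\<nu>, l)\<in>{(0, 0)}. (1/4 :: real) ^ (2 * \<nu> - l)) \<le> quarter_mass"
    unfolding quarter_mass_def using abs_summable_summable[OF quarter_weight_summable]
    by (rule finite_sum_le_infsum) (auto simp: exponent_pairs_def)
  thus ?thesis by simp
qed

lemma multi_quarter_weight:
  assumes A: "finite A"
  shows "((\<lambda>g. (1/4 :: real) ^ multi_weight A g) has_sum quarter_mass ^ card A) (multi_exponents A)"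
proof -
  have eq: "(\<Prod>j\<in>A. (\<lambda>(\<nu>, l). (1/4 :: real) ^ (2 * \<nu> - l)) (g j)) = (1/4) ^ multi_weight A g" for g
    by (simp add: multi_weight_def power_sum split_beta)
  have "infsum (\<lambda>g. \<Prod>j\<in>A. (\<lambda>(\<nu>, l). (1/4 :: real) ^ (2 * \<nu> - l)) (g j)) (multi_exponents A)
      = (\<Prod>j\<in>A. quarter_mass)"
    unfolding quarter_mass_def by (rule infsum_prod_PiE_abs[OF A quarter_weight_summable])
  hence inf: "infsum (\<lambda>g. (1/4 :: real) ^ multi_weight A g) (multi_exponents A) = quarter_mass ^ card A"
    unfolding eq by simp
  \<comment> \<open>a nonzero value of infsum already certifies summability\<close>
  hence "(\<lambda>g. (1/4 :: real) ^ multi_weight A g) summable_on multi_exponents A"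
    using infsum_not_exists quarter_mass_pos by (metis less_irrefl zero_less_power)
  thus ?thesis using inf by (metis has_sum_infsum)
qed

text \<open>From \<open>l \<le> \<nu>\<close> follows \<open>\<nu> \<le> 2 * \<nu> - l\<close>, so a
  bound on the weight bounds every exponent.\<close>

lemma finite_multi_weight_less: "finite A \<Longrightarrow> finite {g \<in> multi_exponents A. multi_weight A g < M}"
proof (rule finite_subset)
  assume A: "finite A"
  show "finite (PiE A (\<lambda>_. {..M} \<times> {..M}))" using A by (intro finite_PiE) auto
  show "{g \<in> multi_exponents A. multi_weight A g < M} \<subseteq> PiE A (\<lambda>_. {..M} \<times> {..M})"
  proof
    fix g assume g: "g \<in> {g \<in> multi_exponents A. multi_weight A g < M}"
    have "g j \<in> {..M} \<times> {..M}" if j: "j \<in> A" for j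
    proof -
      have "snd (g j) \<le> fst (g j)" using g j by (force simp: exponent_pairs_def PiE_iff)
      moreover have "2 * fst (g j) - snd (g j) \<le> multi_weight A g"
        unfolding multi_weight_def by (rule member_le_sum) (use A j in auto)
      ultimately show ?thesis using g by (auto simp: mem_Times_iff)
    qed
    thus "g \<in> PiE A (\<lambda>_. {..M} \<times> {..M})" using g by (auto simp: PiE_iff)
  qed
qed

context
  fixes A :: "'a set" and t :: "'a \<Rightarrow> nat \<times> nat \<Rightarrow> complex" and C W :: real
  assumes A: "finite A" and W: "W \<ge> 0" and C: "C \<ge> 0"
    and t: "\<And>j \<nu> l. j \<in> A \<Longrightarrow> l \<le> \<nu> \<Longrightarrow> cmod (t j (\<nu>, l)) \<le> C * W ^ (2 * \<nu> - l)"
begin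

text \<open>Writing \<open>W = (4 * W) * (1/4)\<close> separates a factor summable over all
  exponents from a power of \<open>4 * W\<close>, which the next two estimates compare with
  \<open>(4 * W) ^ M\<close>.\<close>

lemma norm_multi_term_le:
  assumes g: "g \<in> multi_exponents A"
  shows "cmod (\<Prod>j\<in>A. t j (g j)) \<le> C ^ card A * ((4 * W) ^ multi_weight A g * (1/4) ^ multi_weight A g)"
proof -
  have "cmod (\<Prod>j\<in>A. t j (g j)) \<le> (\<Prod>j\<in>A. C * W ^ (2 * fst (g j) - snd (g j)))"
    unfolding prod_norm[symmetric]
  proof (intro prod_mono conjI norm_ge_zero)
    fix j assume j: "j \<in> A"
    have "snd (g j) \<le> fst (g j)" using g j by (force simp: exponent_pairs_def PiE_iff)
    thus "cmod (t j (g j)) \<le> C * W ^ (2 * fst (g j) - snd (g j))"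
      using t[OF j, of "snd (g j)" "fst (g j)"] by simp
  qed
  also have "\<dots> = C ^ card A * W ^ multi_weight A g"
    by (simp add: prod.distrib multi_weight_def power_sum)
  also have "W ^ multi_weight A g = (4 * W) ^ multi_weight A g * (1/4) ^ multi_weight A g"
    using power_mult_distrib[of "4 * W" "1/4" "multi_weight A g"] by simp
  finally show ?thesis .
qed

text \<open>The remainder consists of the weights at least \<open>M\<close>, where
  \<open>4 * W \<le> 1\<close> gives
  \<open>(4 * W) ^ multi_weight A g \<le> (4 * W) ^ M\<close>.\<close>

lemma multi_sum_remainder:
  assumes W4: "W \<le> 1/4" and summ: "\<And>j. j \<in> A \<Longrightarrow> (\<lambda>b. norm (t j b)) summable_on exponent_pairs"
  shows "cmod ((\<Prod>j\<in>A. infsum (t j) exponent_pairs)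
           - (\<Sum>g\<in>{g \<in> multi_exponents A. multi_weight A g < M}. \<Prod>j\<in>A. t j (g j)))
         \<le> (C * quarter_mass) ^ card A * (4 * W) ^ M"
proof -
  let ?T = "\<lambda>g. \<Prod>j\<in>A. t j (g j)" and ?J = "multi_exponents A"
  let ?F = "{g \<in> ?J. multi_weight A g < M}"
  note q = multi_quarter_weight[OF A]
  have q_summ: "(\<lambda>g. (1/4 :: real) ^ multi_weight A g) summable_on ?J" using q by (rule has_sum_imp_summable)
  have "(\<lambda>g. C ^ card A * (1/4 :: real) ^ multi_weight A g) summable_on ?J"
    by (intro summable_on_cmult_right q_summ)
  hence abs: "(\<lambda>g. norm (?T g)) summable_on ?J"
  proof (rule summable_on_comparison_test)
    fix g assume g: "g \<in> ?J"
    have "(4 * W) ^ multi_weight A g * (1/4) ^ multi_weight A g \<le> 1 * (1/4) ^ multi_weight A g"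
      using W W4 by (intro mult_right_mono power_le_one) auto
    hence "C ^ card A * ((4 * W) ^ multi_weight A g * (1/4) ^ multi_weight A g) \<le> C ^ card A * (1/4) ^ multi_weight A g"
      using C by (intro mult_left_mono) auto
    thus "cmod (?T g) \<le> C ^ card A * (1/4) ^ multi_weight A g"
      using norm_multi_term_le[OF g] by linarith
  qed auto
  have fin: "finite ?F" by (rule finite_multi_weight_less[OF A])
  have "(\<Prod>j\<in>A. infsum (t j) exponent_pairs) = infsum ?T ?J"
    by (rule infsum_prod_PiE_abs[symmetric, OF A summ])
  moreover have "infsum ?T (?J - ?F) = infsum ?T ?J - infsum ?T ?F"
    by (rule infsum_Diff) (use abs_summable_summable[OF abs] fin in auto)
  ultimately have eq: "(\<Prod>j\<in>A. infsum (t j) exponent_pairs) - sum ?T ?F = infsum ?T (?J - ?F)"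
    using fin by simp
  have abs': "(\<lambda>g. norm (?T g)) summable_on (?J - ?F)"
    by (rule summable_on_subset_banach[OF abs]) auto
  have "cmod (infsum ?T (?J - ?F)) \<le> infsum (\<lambda>g. cmod (?T g)) (?J - ?F)"
    by (rule norm_infsum_bound[OF abs'])
  also have "\<dots> \<le> infsum (\<lambda>g. C ^ card A * (4 * W) ^ M * (1/4) ^ multi_weight A g) ?J"
  proof (rule infsum_mono_neutral[OF abs'])
    show "(\<lambda>g. C ^ card A * (4 * W) ^ M * (1/4) ^ multi_weight A g) summable_on ?J"
      by (intro summable_on_cmult_right q_summ)
    fix g assume g: "g \<in> (?J - ?F) \<inter> ?J"
    hence "(4 * W) ^ multi_weight A g \<le> (4 * W) ^ M"
      using W W4 by (intro power_decreasing) auto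
    hence "C ^ card A * ((4 * W) ^ multi_weight A g * (1/4) ^ multi_weight A g)
        \<le> C ^ card A * ((4 * W) ^ M * (1/4) ^ multi_weight A g)"
      using C by (intro mult_left_mono mult_right_mono) auto
    thus "cmod (?T g) \<le> C ^ card A * (4 * W) ^ M * (1/4) ^ multi_weight A g"
      using norm_multi_term_le[of g] g by (simp add: mult.assoc)
  qed (use C W in auto)
  also have "\<dots> = C ^ card A * (4 * W) ^ M * quarter_mass ^ card A"
    by (simp only: infsum_cmult_right' infsumI[OF q])
  finally show ?thesis unfolding eq by (simp add: power_mult_distrib mult_ac)
qed

text \<open>The complementary regime \<open>4 * W \<ge> 1\<close>, without any convergence: now the
  weights below \<open>M\<close> satisfy the same inequality, so the truncated sum itself obeys the
  bound of the remainder.\<close>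

lemma multi_sum_truncated_bound:
  assumes W4: "W \<ge> 1/4"
  shows "cmod (\<Sum>g\<in>{g \<in> multi_exponents A. multi_weight A g < M}. \<Prod>j\<in>A. t j (g j))
         \<le> (C * quarter_mass) ^ card A * (4 * W) ^ M"
proof -
  let ?T = "\<lambda>g. \<Prod>j\<in>A. t j (g j)" and ?J = "multi_exponents A"
  let ?F = "{g \<in> ?J. multi_weight A g < M}"
  note q = multi_quarter_weight[OF A]
  have fin: "finite ?F" by (rule finite_multi_weight_less[OF A])
  have "cmod (sum ?T ?F) \<le> (\<Sum>g\<in>?F. C ^ card A * ((4 * W) ^ M * (1/4) ^ multi_weight A g))"
  proof (rule sum_norm_le)
    fix g assume g: "g \<in> ?F"
    hence "(4 * W) ^ multi_weight A g \<le> (4 * W) ^ M"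
      using W4 by (intro power_increasing) auto
    hence "C ^ card A * ((4 * W) ^ multi_weight A g * (1/4) ^ multi_weight A g)
        \<le> C ^ card A * ((4 * W) ^ M * (1/4) ^ multi_weight A g)"
      using C by (intro mult_left_mono mult_right_mono) auto
    thus "cmod (?T g) \<le> C ^ card A * ((4 * W) ^ M * (1/4) ^ multi_weight A g)"
      using norm_multi_term_le[of g] g by auto
  qed
  also have "\<dots> = C ^ card A * (4 * W) ^ M * (\<Sum>g\<in>?F. (1/4) ^ multi_weight A g)"
    by (simp add: sum_distrib_left mult.assoc)
  also have "\<dots> \<le> C ^ card A * (4 * W) ^ M * quarter_mass ^ card A"
  proof (intro mult_left_mono)
    show "(\<Sum>g\<in>?F. (1/4) ^ multi_weight A g) \<le> quarter_mass ^ card A"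
      unfolding infsumI[OF q, symmetric]
      by (rule finite_sum_le_infsum[OF has_sum_imp_summable[OF q] fin]) auto
  qed (use C W in auto)
  finally show ?thesis by (simp add: power_mult_distrib mult_ac)
qed

end

text \<open>Converts the Gaussian moment \<open>(2 * p)! / (2 ^ p * p!)\<close> into the Gamma
  factor of \<open>asym_term\<close>, up to a power of 2; the induction is the functional
  equation.\<close>

lemma Gamma_plus_half_nat:
  "Gamma ((real (2 * p) + 1) / 2) / sqrt pi = fact (2 * p) / (4 ^ p * fact p)"
proof (induction p)
  case 0
  show ?case by (simp add: Gamma_one_half_real)
next
  case (Suc p)
  have "(real (2 * Suc p) + 1) / 2 = (real (2 * p) + 1) / 2 + 1" by simp
  hence "Gamma ((real (2 * Suc p) + 1) / 2) = (real (2 * p) + 1) / 2 * Gamma ((real (2 * p) + 1) / 2)"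
    by (simp only:) (rule Gamma_plus1, auto simp: nonpos_Ints_def)
  hence "Gamma ((real (2 * Suc p) + 1) / 2) / sqrt pi
      = (real (2 * p) + 1) / 2 * (Gamma ((real (2 * p) + 1) / 2) / sqrt pi)"
    by (simp only: times_divide_eq_right)
  also have "\<dots> = (real (2 * p) + 1) / 2 * (fact (2 * p) / (4 ^ p * fact p))"
    unfolding Suc ..
  also have "\<dots> = (2 * (real p + 1) * (real (2 * p) + 1) * fact (2 * p)) / (4 * (real p + 1) * (4 ^ p * fact p))"
    by (simp add: divide_simps del: of_nat_mult)
  also have "2 * (real p + 1) * (real (2 * p) + 1) * fact (2 * p) = fact (2 * Suc p)"
    by (simp add: algebra_simps)
  also have "4 * (real p + 1) * (4 ^ p * fact p) = 4 ^ Suc p * fact (Suc p)"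
    by (simp add: algebra_simps)
  finally show ?case .
qed

subsection \<open>Truncation error\<close>

text \<open>The two kinds of modes form one indexed family: the first \<open>m\<close> have Euler
  argument 1, numerator \<open>exp w\<close> and a reversed phase, the others Euler argument 0 and
  numerator 1.\<close>

definition mode_arg :: "nat \<Rightarrow> nat \<Rightarrow> complex" where
  "mode_arg m j = (if j \<le> m then 1 else 0)"

definition mode_sign :: "nat \<Rightarrow> nat \<Rightarrow> complex" where
  "mode_sign m j = (if j \<le> m then -1 else 1)"

definition mode_energy :: "nat \<Rightarrow> (nat \<Rightarrow> nat) \<Rightarrow> (nat \<Rightarrow> nat) \<Rightarrow> nat \<Rightarrow> real" where
  "mode_energy m r s j = (if j \<le> m then real (r j) else real (s j)) + 1/2"

definition mode_phase :: "nat \<Rightarrow> (nat \<Rightarrow> nat) \<Rightarrow> (nat \<Rightarrow> nat) \<Rightarrow> real \<Rightarrow> real \<Rightarrow> nat \<Rightarrow> complex" where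
  "mode_phase m r s y v j =
     mode_sign m j * (\<i> * of_real (sqrt (2 * pi * y) * v)) + of_real (- (2 * pi * y * mode_energy m r s j))"

definition fermi_factor :: "nat \<Rightarrow> (nat \<Rightarrow> nat) \<Rightarrow> (nat \<Rightarrow> nat) \<Rightarrow> real \<Rightarrow> real \<Rightarrow> nat \<Rightarrow> complex" where
  "fermi_factor m r s y v j =
     exp (mode_arg m j * mode_phase m r s y v j) / (exp (mode_phase m r s y v j) + 1)"

lemma exp_minus_pi_power:
  "complex_of_real (exp (- pi * y) ^ (2 * k + 1)) = exp (of_real (- (2 * pi * y * (real k + 1/2))))"
proof -
  have "exp (- pi * y) ^ (2 * k + 1) = exp (- (2 * pi * y * (real k + 1/2)))"
    by (simp only: exp_of_nat_mult[symmetric]) (simp add: algebra_simps)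
  thus ?thesis by (simp only: exp_of_real)
qed

text \<open>The phase of charge \<open>m\<close> splits into \<open>m\<close> equal factors;
  together with \<open>x ^ (2 * r j + 1)\<close> each turns a reciprocal \<open>1 / (1 + z)\<close>
  into \<open>z / (1 + z)\<close>.\<close>

lemma G_coeff_eq_integral:
  fixes smul :: "complex \<Rightarrow> 'f::ab_group_add \<Rightarrow> 'f"
  assumes fock: "fermionic_fock_space smul psi psis vac"
    and m: "m \<le> n" and inj_r: "inj_on r {1..m}" and inj_s: "inj_on s {m+1..n}" and y: "y > 0"
  shows "G_coeff smul psi psis vac n m r s (\<i> * of_real y)
    = (CLINT v|std_normal_distribution. \<Prod>j=1..n. fermi_factor m r s y v j)"
proof -
  define x where "x = exp (- pi * y)"
  define w where "w = sqrt (2 * pi * y)"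
  let ?S = "s ` {m+1..n}" and ?R = "r ` {1..m}"
  have "G_coeff smul psi psis vac n m r s (\<i> * of_real y) = of_real (\<Prod>j=1..m. x ^ (2 * r j + 1)) *
      (CLINT v|std_normal_distribution. iexp (- (of_int (int m) * w) * v) * fermi_kernel x w ?S ?R v)"
    unfolding G_coeff_eq_charge_sum[OF fock m inj_r y] x_def w_def of_real_mult[of "prod _ _"]
    by (subst charge_sum_eq_gaussian_integral[OF y]) auto
  also have "\<dots> = (CLINT v|std_normal_distribution. of_real (\<Prod>j=1..m. x ^ (2 * r j + 1)) *
      (iexp (- (of_int (int m) * w) * v) * fermi_kernel x w ?S ?R v))"
    by (rule integral_mult_right_zero[symmetric])
  also have "\<dots> = (CLINT v|std_normal_distribution. \<Prod>j=1..n. fermi_factor m r s y v j)"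
  proof (rule Bochner_Integration.integral_cong[OF refl])
    fix v
    have 1: "fermi_factor m r s y v j = iexp (- (w * v)) * of_real (x ^ (2 * r j + 1))
        * (1 / (1 + iexp (- (w * v)) * of_real (x ^ (2 * r j + 1))))" if "j \<in> {1..m}" for j
      using that unfolding fermi_factor_def mode_phase_def mode_arg_def mode_sign_def mode_energy_def x_def
        exp_minus_pi_power w_def by (simp add: exp_add[symmetric] add.commute)
    have 2: "fermi_factor m r s y v j = 1 / (1 + iexp (w * v) * of_real (x ^ (2 * s j + 1)))"
      if "j \<in> {m+1..n}" for j
      using that unfolding fermi_factor_def mode_phase_def mode_arg_def mode_sign_def mode_energy_def x_def
        exp_minus_pi_power w_def by (simp add: exp_add[symmetric] add.commute)
    have 3: "iexp (- (of_int (int m) * w) * v) = (\<Prod>j=1..m. iexp (- (w * v)))"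
      by (simp add: exp_of_nat_mult[symmetric] mult_ac)
    have "{1..n} = {1..m} \<union> {m+1..n}" using m by auto
    hence "(\<Prod>j=1..n. fermi_factor m r s y v j)
        = (\<Prod>j=1..m. fermi_factor m r s y v j) * (\<Prod>j=m+1..n. fermi_factor m r s y v j)"
      by (simp add: prod.union_disjoint)
    also have "\<dots> = (\<Prod>j=1..m. iexp (- (w * v)) * of_real (x ^ (2 * r j + 1))
        * (1 / (1 + iexp (- (w * v)) * of_real (x ^ (2 * r j + 1)))))
        * (\<Prod>j=m+1..n. 1 / (1 + iexp (w * v) * of_real (x ^ (2 * s j + 1))))"
      by (intro arg_cong2[of _ _ _ _ "(*)"] prod.cong refl 1 2)
    also have "\<dots> = of_real (\<Prod>j=1..m. x ^ (2 * r j + 1)) *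
      (iexp (- (of_int (int m) * w) * v) * fermi_kernel x w ?S ?R v)"
      unfolding 3 fermi_kernel_def prod.reindex[OF inj_r] prod.reindex[OF inj_s] o_def prod.distrib of_real_prod
      by (simp only: mult_ac)
    finally show "of_real (\<Prod>j=1..m. x ^ (2 * r j + 1)) *
      (iexp (- (of_int (int m) * w) * v) * fermi_kernel x w ?S ?R v) = (\<Prod>j=1..n. fermi_factor m r s y v j)" ..
  qed
  finally show ?thesis .
qed

text \<open>All energies are at least \<open>1/2\<close>, so
  \<open>cmod (exp w) \<le> exp (- y) \<le> 1 - y / 2\<close> and the denominator stays
  \<open>y / 2\<close> away from 0. The bound is crude in \<open>y\<close> but uniform in
  \<open>v\<close>.\<close>

lemma norm_fermi_factor_le:
  assumes y: "0 < y" "y \<le> 1"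
  shows "cmod (fermi_factor m r s y v j) \<le> 2 / y"
proof -
  define w where "w = mode_phase m r s y v j"
  have Re_w: "Re w = - (2 * pi * y * mode_energy m r s j)"
    by (simp add: w_def mode_phase_def mode_sign_def)
  have "2 * pi * mode_energy m r s j \<ge> 2 * 1 * (1/2)"
    using pi_ge_two by (intro mult_mono) (auto simp: mode_energy_def)
  hence "y \<le> y * (2 * pi * mode_energy m r s j)" using y by (simp add: mult_le_cancel_left1)
  hence Re_le: "Re w \<le> - y" unfolding Re_w by (simp add: mult_ac)
  have "exp (- y) \<le> 1 - y / 2"
  proof -
    have "1 \<le> (1 - y / 2) * (1 + y)"
      using y mult_left_le[of y y] by (simp add: algebra_simps)
    also have "\<dots> \<le> (1 - y / 2) * exp y"
      using y exp_ge_add_one_self[of y] by (intro mult_left_mono) auto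
    finally show ?thesis by (simp add: exp_minus field_simps)
  qed
  hence "cmod (exp w) \<le> 1 - y / 2"
    using Re_le by (simp add: norm_exp_eq_Re) (meson exp_le_cancel_iff order_trans)
  hence "y / 2 \<le> cmod (exp w + 1)"
    using norm_triangle_ineq4[of "exp w + 1" "exp w"] by simp
  moreover have "cmod (exp (mode_arg m j * w)) \<le> 1"
    using Re_le y by (auto simp: mode_arg_def norm_exp_eq_Re)
  ultimately have "cmod (exp (mode_arg m j * w)) / cmod (exp w + 1) \<le> 1 / (y / 2)"
    using y by (intro frac_le) auto
  thus ?thesis by (simp add: fermi_factor_def w_def norm_divide)
qed

definition mode_term ::
  "nat \<Rightarrow> (nat \<Rightarrow> nat) \<Rightarrow> (nat \<Rightarrow> nat) \<Rightarrow> real \<Rightarrow> real \<Rightarrow> nat \<Rightarrow> nat \<times> nat \<Rightarrow> complex" where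
  "mode_term m r s y v j = (\<lambda>(\<nu>, l). euler_coeff (mode_arg m j) \<nu> / 2 * of_nat (\<nu> choose l)
      * (mode_sign m j * (\<i> * of_real (sqrt (2 * pi * y) * v))) ^ l
      * of_real (- (2 * pi * y * mode_energy m r s j)) ^ (\<nu> - l))"

text \<open>The cutoff keeps weights up to \<open>2 * K + 1\<close>. Even weights are powers of
  \<open>y\<close> up to \<open>K\<close>; odd weights carry an odd power of \<open>v\<close> and
  vanish on integration.\<close>

definition truncated_product ::
  "nat \<Rightarrow> nat \<Rightarrow> (nat \<Rightarrow> nat) \<Rightarrow> (nat \<Rightarrow> nat) \<Rightarrow> nat \<Rightarrow> real \<Rightarrow> real \<Rightarrow> complex" where
  "truncated_product n m r s K y v =
     (\<Sum>g\<in>{g \<in> multi_exponents {1..n}. multi_weight {1..n} g < 2 * K + 2}.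
        \<Prod>j=1..n. mode_term m r s y v j (g j))"

text \<open>For small \<open>W\<close> the series converge and the tail is estimated; for large
  \<open>W\<close> product and truncation are bounded separately. The constants are independent of
  \<open>K\<close>, as a truncation order depending on \<open>y\<close> requires.\<close>

lemma fermi_product_remainder:
  obtains \<beta> C y0 where "\<beta> > 0" "C > 0" "0 < y0" "y0 \<le> 1"
    "\<And>y v K. 0 < y \<Longrightarrow> y < y0 \<Longrightarrow>
       cmod ((\<Prod>j=1..n. fermi_factor m r s y v j) - truncated_product n m r s K y v)
         \<le> C * (\<beta> * y) ^ (K + 1) * (v ^ (2 * (K + 1)) + 1 + v ^ (2 * (K + 1 + n)))"
proof -
  obtain R C where R: "R > 0" and C: "C > 0"
    and coeff: "\<And>x k. x \<in> {0, 1} \<Longrightarrow> cmod (euler_coeff x k) \<le> C * R ^ k"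
    and sums: "\<And>x w. x \<in> {0, 1} \<Longrightarrow> cmod w * R < 1 \<Longrightarrow>
         (\<lambda>k. euler_coeff x k * w ^ k) sums (2 * exp (x * w) / (exp w + 1))"
    using euler_coeff_bound by blast
  define \<rho> where "\<rho> = (\<Sum>j=1..n. mode_energy m r s j) + 1"
  have energy_pos: "mode_energy m r s j > 0" for j by (simp add: mode_energy_def)
  have \<rho>: "mode_energy m r s j \<le> \<rho>" if "j \<in> {1..n}" for j
    using member_le_sum[of j "{1..n}" "mode_energy m r s"] that energy_pos by (auto simp: \<rho>_def less_imp_le)
  have "(\<Sum>j=1..n. mode_energy m r s j) \<ge> 0" by (intro sum_nonneg less_imp_le energy_pos)
  hence \<rho>_pos: "\<rho> > 0" by (simp add: \<rho>_def)
  \<comment> \<open>Chosen so that \<open>\<kappa> * y\<close> bounds \<open>2 * R\<close> times the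
    absolute real part of every phase.\<close>
  define \<kappa> where "\<kappa> = 4 * pi * R * \<rho>"
  have \<kappa>: "\<kappa> > 0" using R \<rho>_pos by (simp add: \<kappa>_def)
  \<comment> \<open>The summands come from \<open>(4 * (2 * R * \<bar>\<theta>\<bar>))\<^sup>2 = 128
    * pi * R\<^sup>2 * y * v\<^sup>2\<close> and
    \<open>(4 * sqrt (\<kappa> * y))\<^sup>2 = 16 * \<kappa> * y\<close>.\<close>
  define \<beta> where "\<beta> = 128 * pi * R\<^sup>2 + 16 * \<kappa>"
  have \<beta>: "\<beta> > 0" using \<kappa> R by (simp add: \<beta>_def add_nonneg_pos)
  \<comment> \<open>Below \<open>y0\<close> one has \<open>sqrt (\<kappa> * y) < 1/4\<close>, so
    only a large \<open>\<theta>\<close> can make \<open>W\<close> exceed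
    \<open>1/4\<close>.\<close>
  define y0 where "y0 = min 1 (1 / (16 * \<kappa>))"
  define Q where "Q = (C * quarter_mass) ^ n"
  have Q: "Q > 0" using C quarter_mass_pos by (simp add: Q_def)
  have bound: "cmod ((\<Prod>j=1..n. fermi_factor m r s y v j) - truncated_product n m r s K y v)
      \<le> (Q + (2 * \<beta>) ^ n) * (\<beta> * y) ^ (K + 1) * (v ^ (2 * (K + 1)) + 1 + v ^ (2 * (K + 1 + n)))"
    if y: "0 < y" "y < y0" for y v K
  proof -
    define \<theta> where "\<theta> = sqrt (2 * pi * y) * v"
    \<comment> \<open>After scaling by \<open>2 * R\<close>, imaginary parts are at most
      \<open>W\<close> and real parts at most \<open>W\<^sup>2\<close> in size. The factor
      \<open>R\<close> is the coefficient growth, the 2 pays for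
      \<open>\<nu> choose l \<le> 2 ^ \<nu>\<close>.\<close>
    define W where "W = max (2 * R * \<bar>\<theta>\<bar>) (sqrt (\<kappa> * y))"
    have y1: "y \<le> 1" and \<kappa>y: "\<kappa> * y < 1/16"
      using y \<kappa> by (auto simp: y0_def field_simps)
    have W: "W \<ge> 0" using R by (auto simp: W_def le_max_iff_disj)
    have sqrt_le: "sqrt (\<kappa> * y) < 1/4"
      using real_sqrt_less_mono[OF \<kappa>y] by (simp add: real_sqrt_divide)
    have \<kappa>y_W: "\<kappa> * y \<le> W\<^sup>2"
    proof -
      have "(sqrt (\<kappa> * y))\<^sup>2 \<le> W\<^sup>2" using \<kappa> y by (intro power_mono) (auto simp: W_def)
      thus ?thesis using \<kappa> y by simp
    qed
    have arg: "mode_arg m j \<in> {0, 1}" for j by (simp add: mode_arg_def)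
    have normX: "cmod (mode_sign m j * (\<i> * of_real \<theta>)) = \<bar>\<theta>\<bar>" for j
      by (simp add: mode_sign_def norm_mult)
    have normY: "cmod (of_real (- (2 * pi * y * mode_energy m r s j))) = 2 * pi * y * mode_energy m r s j" for j
      unfolding norm_of_real using y energy_pos[of j] by simp
    have Y_le: "2 * R * (2 * pi * y * mode_energy m r s j) \<le> W\<^sup>2" if "j \<in> {1..n}" for j
    proof -
      have "2 * R * (2 * pi * y * mode_energy m r s j) \<le> 2 * R * (2 * pi * y * \<rho>)"
        using R y \<rho>[OF that] by (intro mult_left_mono) auto
      also have "\<dots> = \<kappa> * y" by (simp add: \<kappa>_def)
      finally show ?thesis using \<kappa>y_W by linarith
    qed
    have X_le: "2 * R * \<bar>\<theta>\<bar> \<le> W" by (simp add: W_def)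
    have term_le: "cmod (mode_term m r s y v j (\<nu>, l)) \<le> C * W ^ (2 * \<nu> - l)"
      if j: "j \<in> {1..n}" and l: "l \<le> \<nu>" for j \<nu> l
    proof -
      let ?Y = "2 * pi * y * mode_energy m r s j"
      have Y0: "?Y \<ge> 0" using y energy_pos[of j] by simp
      have a: "cmod (euler_coeff (mode_arg m j) \<nu> / 2) \<le> C * R ^ \<nu>"
        using coeff[OF arg, of j \<nu>] by (simp add: norm_divide) (smt (verit) norm_ge_zero)
      have b: "real (\<nu> choose l) \<le> 2 ^ \<nu>"
        using binomial_le_pow2[of \<nu> l] by (metis of_nat_le_iff of_nat_numeral of_nat_power)
      have "cmod (mode_term m r s y v j (\<nu>, l))
          = cmod (euler_coeff (mode_arg m j) \<nu> / 2) * real (\<nu> choose l) * \<bar>\<theta>\<bar> ^ l * ?Y ^ (\<nu> - l)"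
        unfolding mode_term_def prod.case \<theta>_def[symmetric] norm_mult[of _ "_ ^ _"] norm_power normX normY
        by (simp add: norm_mult)
      also have "\<dots> \<le> (C * R ^ \<nu>) * 2 ^ \<nu> * \<bar>\<theta>\<bar> ^ l * ?Y ^ (\<nu> - l)"
        using C R Y0 by (intro mult_right_mono mult_mono a b) auto
      also have "\<dots> = C * ((2 * R) ^ \<nu> * \<bar>\<theta>\<bar> ^ l * ?Y ^ (\<nu> - l))"
        by (simp add: power_mult_distrib mult_ac)
      also have "(2 * R) ^ \<nu> = (2 * R) ^ l * (2 * R) ^ (\<nu> - l)"
        unfolding power_add[symmetric] using l by simp
      also have "C * ((2 * R) ^ l * (2 * R) ^ (\<nu> - l) * \<bar>\<theta>\<bar> ^ l * ?Y ^ (\<nu> - l))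
          = C * ((2 * R * \<bar>\<theta>\<bar>) ^ l * (2 * R * ?Y) ^ (\<nu> - l))"
        by (simp only: power_mult_distrib mult_ac)
      also have "\<dots> \<le> C * (W ^ l * (W\<^sup>2) ^ (\<nu> - l))"
        using C R W Y0 Y_le[OF j] X_le by (intro mult_left_mono mult_mono power_mono) auto
      also have "W ^ l * (W\<^sup>2) ^ (\<nu> - l) = W ^ (l + 2 * (\<nu> - l))"
        by (simp add: power_add power_mult)
      also have "l + 2 * (\<nu> - l) = 2 * \<nu> - l" using l by simp
      finally show ?thesis .
    qed
    have \<theta>_pow: "(4 * (2 * R * \<bar>\<theta>\<bar>)) ^ (2 * p) \<le> (\<beta> * y) ^ p * v ^ (2 * p)" for p
    proof -
      have "(4 * (2 * R * \<bar>\<theta>\<bar>))\<^sup>2 = (128 * pi * R\<^sup>2) * y * v\<^sup>2"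
        using y by (simp add: \<theta>_def power_mult_distrib abs_mult)
      hence "(4 * (2 * R * \<bar>\<theta>\<bar>)) ^ (2 * p) = ((128 * pi * R\<^sup>2) * y * v\<^sup>2) ^ p"
        by (simp only: power_mult)
      also have "\<dots> \<le> (\<beta> * y * v\<^sup>2) ^ p"
        using y \<kappa> by (intro power_mono mult_right_mono) (auto simp: \<beta>_def)
      also have "\<dots> = (\<beta> * y) ^ p * v ^ (2 * p)"
        by (simp only: power_mult_distrib power_mult)
      finally show ?thesis .
    qed
    have W_pow: "(4 * W) ^ (2 * (K + 1)) \<le> (\<beta> * y) ^ (K + 1) * (v ^ (2 * (K + 1)) + 1)"
    proof -
      have max_pow: "(4 * max a b) ^ k \<le> (4 * a) ^ k + (4 * b) ^ k" if "0 \<le> a" "0 \<le> b" for a b :: real and k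
        using that by (simp add: max_def)
      have sq: "(4 * sqrt (\<kappa> * y)) ^ (2 * (K + 1)) \<le> (\<beta> * y) ^ (K + 1)"
      proof -
        have "(4 * sqrt (\<kappa> * y)) ^ (2 * (K + 1)) = (16 * \<kappa> * y) ^ (K + 1)"
          unfolding power_mult using \<kappa> y by (intro arg_cong[of _ _ "\<lambda>z. z ^ (K + 1)"]) (simp add: power_mult_distrib)
        also have "\<dots> \<le> (\<beta> * y) ^ (K + 1)"
          using \<kappa> y by (intro power_mono mult_right_mono) (auto simp: \<beta>_def)
        finally show ?thesis .
      qed
      have "(4 * W) ^ (2 * (K + 1)) \<le> (4 * (2 * R * \<bar>\<theta>\<bar>)) ^ (2 * (K + 1)) + (4 * sqrt (\<kappa> * y)) ^ (2 * (K + 1))"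
        unfolding W_def using R \<kappa> y by (intro max_pow) auto
      also have "\<dots> \<le> (\<beta> * y) ^ (K + 1) * v ^ (2 * (K + 1)) + (\<beta> * y) ^ (K + 1)"
        by (intro add_mono \<theta>_pow sq)
      finally show ?thesis by (simp only: distrib_left mult_1_right)
    qed
    have v_nonneg: "v ^ (2 * p) \<ge> 0" for p by (simp add: power_mult)
    have \<beta>y: "(\<beta> * y) ^ (K + 1) \<ge> 0" using \<beta> y by simp
    have main: "cmod ((\<Prod>j=1..n. fermi_factor m r s y v j) - truncated_product n m r s K y v)
        \<le> Q * ((\<beta> * y) ^ (K + 1) * (v ^ (2 * (K + 1)) + 1)) + (2 * \<beta>) ^ n * ((\<beta> * y) ^ (K + 1) * v ^ (2 * (K + 1 + n)))"
    proof (cases "W \<le> 1/4")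
      case True
      \<comment> \<open>For \<open>W \<le> 1/4\<close> the left side is at most
        \<open>1/8 + 1/32\<close>.\<close>
      have sm: "(\<bar>\<theta>\<bar> + 2 * pi * y * mode_energy m r s j) * R < 1" if "j \<in> {1..n}" for j
      proof -
        have "W\<^sup>2 \<le> (1/4)\<^sup>2" using W True by (intro power_mono) auto
        thus ?thesis using Y_le[OF that] X_le True by (simp add: algebra_simps power2_eq_square)
      qed
      have series: "(\<lambda>b. norm (mode_term m r s y v j b)) summable_on exponent_pairs"
        "infsum (mode_term m r s y v j) exponent_pairs = fermi_factor m r s y v j"
        if j: "j \<in> {1..n}" for j
      proof -
        let ?X = "mode_sign m j * (\<i> * of_real \<theta>)" and ?Y = "complex_of_real (- (2 * pi * y * mode_energy m r s j))"
        have XY: "(cmod ?X + cmod ?Y) * R < 1" using sm[OF j] unfolding normX normY .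
        moreover have "cmod (?X + ?Y) * R \<le> (cmod ?X + cmod ?Y) * R"
          using R by (intro mult_right_mono norm_triangle_ineq) auto
        ultimately have series0: "(\<lambda>k. euler_coeff (mode_arg m j) k * (?X + ?Y) ^ k)
            sums (2 * exp (mode_arg m j * (?X + ?Y)) / (exp (?X + ?Y) + 1))"
          by (intro sums[OF arg]) linarith
        have half: "2 * a / b / 2 = a / b" for a b :: complex by simp
        from sums_divide[OF series0, of 2]
        have s: "(\<lambda>k. euler_coeff (mode_arg m j) k / 2 * (?X + ?Y) ^ k) sums fermi_factor m r s y v j"
          unfolding fermi_factor_def mode_phase_def \<theta>_def[symmetric] by (simp only: half times_divide_eq_left)
        have a: "cmod (euler_coeff (mode_arg m j) k / 2) \<le> C * R ^ k" for k
          using coeff[OF arg, of j k] by (simp add: norm_divide) (smt (verit) norm_ge_zero)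
        have R0: "R \<ge> 0" using R by simp
        show "(\<lambda>b. norm (mode_term m r s y v j b)) summable_on exponent_pairs"
          "infsum (mode_term m r s y v j) exponent_pairs = fermi_factor m r s y v j"
          unfolding mode_term_def \<theta>_def[symmetric] by (rule binomial_expansion_abs_summable[OF a R0 XY s])+
      qed
      have "cmod ((\<Prod>j\<in>{1..n}. infsum (mode_term m r s y v j) exponent_pairs) - truncated_product n m r s K y v)
          \<le> (C * quarter_mass) ^ card {1..n} * (4 * W) ^ (2 * K + 2)"
        unfolding truncated_product_def
        by (rule multi_sum_remainder[OF _ W _ term_le True series(1)]) (use C in auto)
      moreover have "(\<Prod>j\<in>{1..n}. infsum (mode_term m r s y v j) exponent_pairs) = (\<Prod>j=1..n. fermi_factor m r s y v j)"
        by (intro prod.cong refl series(2))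
      ultimately have "cmod ((\<Prod>j=1..n. fermi_factor m r s y v j) - truncated_product n m r s K y v)
          \<le> Q * (4 * W) ^ (2 * (K + 1))"
        by (simp add: Q_def)
      also have "\<dots> \<le> Q * ((\<beta> * y) ^ (K + 1) * (v ^ (2 * (K + 1)) + 1))"
        using Q by (intro mult_left_mono W_pow) auto
      moreover have "0 \<le> (2 * \<beta>) ^ n * ((\<beta> * y) ^ (K + 1) * v ^ (2 * (K + 1 + n)))"
        by (intro mult_nonneg_nonneg \<beta>y v_nonneg zero_le_power) (use \<beta> in auto)
      ultimately show ?thesis by linarith
    next
      case False
      hence W_eq: "W = 2 * R * \<bar>\<theta>\<bar>" using sqrt_le by (auto simp: W_def max_def)
      have "cmod (truncated_product n m r s K y v) \<le> (C * quarter_mass) ^ card {1..n} * (4 * W) ^ (2 * K + 2)"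
        unfolding truncated_product_def
        by (rule multi_sum_truncated_bound[OF _ W _ term_le]) (use C False in auto)
      hence T: "cmod (truncated_product n m r s K y v) \<le> Q * (4 * W) ^ (2 * (K + 1))"
        by (simp add: Q_def)
      also have "\<dots> \<le> Q * ((\<beta> * y) ^ (K + 1) * (v ^ (2 * (K + 1)) + 1))"
        using Q by (intro mult_left_mono W_pow) auto
      finally have T: "cmod (truncated_product n m r s K y v) \<le> \<dots>" .
      have "cmod (\<Prod>j=1..n. fermi_factor m r s y v j) \<le> (\<Prod>j=1..n. 2 / y)"
        unfolding prod_norm[symmetric] using y y1 by (intro prod_mono conjI norm_fermi_factor_le) auto
      also have "\<dots> = (2 / y) ^ n * 1" by simp
      \<comment> \<open>Here \<open>4 * W > 1\<close>, so any power of it may be inserted; the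
        \<open>2 * n\<close> extra ones supply the \<open>y ^ n\<close> that cancels
        \<open>(2 / y) ^ n\<close>.\<close>
      also have "\<dots> \<le> (2 / y) ^ n * (4 * W) ^ (2 * (K + 1 + n))"
        using y False by (intro mult_left_mono one_le_power) auto
      also have "\<dots> \<le> (2 / y) ^ n * ((\<beta> * y) ^ (K + 1 + n) * v ^ (2 * (K + 1 + n)))"
        unfolding W_eq using y by (intro mult_left_mono \<theta>_pow) auto
      also have "\<dots> = ((2 / y) ^ n * (\<beta> * y) ^ n) * ((\<beta> * y) ^ (K + 1) * v ^ (2 * (K + 1 + n)))"
        by (simp only: power_add[of "\<beta> * y"] mult_ac)
      also have "(2 / y) ^ n * (\<beta> * y) ^ n = (2 * \<beta>) ^ n"
        unfolding power_mult_distrib[symmetric] using y by simp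
      finally have "cmod (\<Prod>j=1..n. fermi_factor m r s y v j)
          \<le> (2 * \<beta>) ^ n * ((\<beta> * y) ^ (K + 1) * v ^ (2 * (K + 1 + n)))" .
      thus ?thesis using T norm_triangle_ineq4[of "\<Prod>j=1..n. fermi_factor m r s y v j" "truncated_product n m r s K y v"]
        by linarith
    qed
    have le: "Q * (b * (p + 1)) + q * (b * z) \<le> (Q + q) * b * (p + 1 + z)"
      if "0 \<le> b" "0 \<le> p" "0 \<le> z" "0 \<le> q" for b p z q :: real
    proof -
      have "0 \<le> Q * b * z + q * b * (p + 1)" using that Q by simp
      thus ?thesis by (simp add: algebra_simps)
    qed
    show ?thesis
      by (rule order_trans[OF main le]) (rule \<beta>y v_nonneg | use \<beta> in simp)+
  qed
  show ?thesis
  proof (rule that[of \<beta> "Q + (2 * \<beta>) ^ n" y0])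
    show "Q + (2 * \<beta>) ^ n > 0" using Q \<beta> by (simp add: add_pos_pos)
    show "0 < y0" "y0 \<le> 1" using \<kappa> by (auto simp: y0_def)
  qed (use \<beta> bound in auto)
qed

section \<open>Gaussian moment bounds and integrability\<close>

lemma std_normal_even_moment_le:
  "(LINT v|std_normal_distribution. v ^ (2 * p)) \<le> 2 ^ p * fact p"
proof -
  \<comment> \<open>The central binomial coefficient is at most \<open>4 ^ p\<close>; dividing by
    the \<open>2 ^ p * p!\<close> of the moment formula leaves growth of order
    \<open>p!\<close>.\<close>
  have "fact (2 * p) = fact p * fact p * real (2 * p choose p)"
    using binomial_fact_lemma[of p "2 * p"] by (metis (no_types) le_add1 mult_2 add_diff_cancel_right' of_nat_fact of_nat_mult)
  also have "\<dots> \<le> fact p * fact p * 2 ^ (2 * p)"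
  proof (rule mult_left_mono)
    show "real (2 * p choose p) \<le> 2 ^ (2 * p)"
      using binomial_le_pow2[of "2 * p" p] by (metis of_nat_le_iff of_nat_numeral of_nat_power)
  qed auto
  also have "\<dots> = (2 ^ p * fact p) * (2 ^ p * fact p)"
    unfolding mult_2[of p] power_add by (simp only: mult_ac)
  finally have "fact (2 * p) \<le> (2 ^ p * fact p) * (2 ^ p * fact p :: real)" .
  thus ?thesis
    unfolding std_normal_distribution_even_moments by (simp add: divide_le_eq)
qed

lemma fact_add_le: "fact (a + n) \<le> (2 ^ (a + n) * fact a * fact n :: real)"
proof -
  have "fact (a + n) = fact a * fact n * real (a + n choose a)"
    using binomial_fact_lemma[of a "a + n"] by (metis le_add1 add_diff_cancel_left' of_nat_fact of_nat_mult)
  also have "\<dots> \<le> fact a * fact n * 2 ^ (a + n)"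
  proof (rule mult_left_mono)
    show "real (a + n choose a) \<le> 2 ^ (a + n)"
      using binomial_le_pow2[of "a + n" a] by (metis of_nat_le_iff of_nat_numeral of_nat_power)
  qed auto
  finally show ?thesis by (simp add: mult_ac)
qed

lemma integrable_fermi_product:
  assumes y: "0 < y" "y \<le> 1"
  shows "complex_integrable std_normal_distribution (\<lambda>v. \<Prod>j=1..n. fermi_factor m r s y v j)"
proof -
  interpret real_distribution std_normal_distribution by (rule real_dist_normal_dist)
  have "cmod (\<Prod>j=1..n. fermi_factor m r s y v j) \<le> (\<Prod>j=1..n. 2 / y)" for v
    unfolding prod_norm[symmetric] using y by (intro prod_mono conjI norm_fermi_factor_le) auto
  moreover have "(\<lambda>v. \<Prod>j=1..n. fermi_factor m r s y v j) \<in> borel_measurable std_normal_distribution"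
    unfolding fermi_factor_def mode_phase_def by measurable
  ultimately show ?thesis
    by (intro integrable_const_bound[where B = "\<Prod>j=1..n. 2 / y"]) auto
qed

section \<open>Termwise integration of the truncated expansion\<close>

definition mode_coeff :: "nat \<Rightarrow> (nat \<Rightarrow> nat) \<Rightarrow> (nat \<Rightarrow> nat) \<Rightarrow> nat \<Rightarrow> nat \<Rightarrow> nat \<Rightarrow> complex" where
  "mode_coeff m r s j \<nu> l = euler_poly \<nu> (mode_arg m j) / (fact l * fact (\<nu> - l))
      * mode_sign m j ^ l * of_real (mode_energy m r s j) ^ (\<nu> - l)"

lemma mode_term_eq:
  assumes "l \<le> \<nu>"
  shows "mode_term m r s y v j (\<nu>, l) = mode_coeff m r s j \<nu> l / 2
     * (\<i> * of_real (sqrt (2 * pi * y))) ^ l * of_real (- (2 * pi * y)) ^ (\<nu> - l) * of_real v ^ l"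
proof -
  have e: "euler_coeff (mode_arg m j) \<nu> * of_nat (\<nu> choose l)
      = euler_poly \<nu> (mode_arg m j) / (fact l * fact (\<nu> - l))"
    unfolding binomial_fact[OF assms] by (simp add: euler_poly_def euler_coeff_def)
  have "mode_term m r s y v j (\<nu>, l) = (euler_coeff (mode_arg m j) \<nu> * of_nat (\<nu> choose l)) / 2
      * (mode_sign m j * (\<i> * of_real (sqrt (2 * pi * y))) * of_real v) ^ l
      * (of_real (- (2 * pi * y)) * of_real (mode_energy m r s j)) ^ (\<nu> - l)"
    by (simp add: mode_term_def mult_ac)
  also have "\<dots> = mode_coeff m r s j \<nu> l / 2
     * (\<i> * of_real (sqrt (2 * pi * y))) ^ l * of_real (- (2 * pi * y)) ^ (\<nu> - l) * of_real v ^ l"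
    unfolding e mode_coeff_def power_mult_distrib by (simp only: times_divide_eq_left times_divide_eq_right mult_ac)
  finally show ?thesis .
qed

lemma prod_mode_term_eq:
  assumes g: "g \<in> multi_exponents {1..n}"
  shows "(\<Prod>j=1..n. mode_term m r s y v j (g j))
    = (\<Prod>j=1..n. mode_coeff m r s j (fst (g j)) (snd (g j))) / 2 ^ n
      * (\<i> * of_real (sqrt (2 * pi * y))) ^ (\<Sum>j=1..n. snd (g j))
      * of_real (- (2 * pi * y)) ^ ((\<Sum>j=1..n. fst (g j)) - (\<Sum>j=1..n. snd (g j)))
      * of_real (v ^ (\<Sum>j=1..n. snd (g j)))"
proof -
  have le: "snd (g j) \<le> fst (g j)" if "j \<in> {1..n}" for j
    using g that by (force simp: exponent_pairs_def PiE_iff)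
  have "(\<Prod>j=1..n. mode_term m r s y v j (g j))
      = (\<Prod>j=1..n. mode_coeff m r s j (fst (g j)) (snd (g j)) / 2
          * (\<i> * of_real (sqrt (2 * pi * y))) ^ snd (g j) * of_real (- (2 * pi * y)) ^ (fst (g j) - snd (g j)) * of_real v ^ snd (g j))"
    by (intro prod.cong refl, subst mode_term_eq[symmetric]) (use le in auto)
  also have "\<dots> = (\<Prod>j=1..n. mode_coeff m r s j (fst (g j)) (snd (g j))) / 2 ^ n
      * (\<i> * of_real (sqrt (2 * pi * y))) ^ (\<Sum>j=1..n. snd (g j))
      * of_real (- (2 * pi * y)) ^ (\<Sum>j=1..n. fst (g j) - snd (g j))
      * of_real v ^ (\<Sum>j=1..n. snd (g j))"
    by (simp only: prod.distrib prod_dividef power_sum prod_constant card_atLeastAtMost diff_Suc_1 add_diff_cancel_right')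
  also have "(\<Sum>j=1..n. fst (g j) - snd (g j)) = (\<Sum>j=1..n. fst (g j)) - (\<Sum>j=1..n. snd (g j))"
    using le by (intro sum_subtractf_nat) auto
  finally show ?thesis by (simp only: of_real_power)
qed

text \<open>Collects the powers of \<open>2 * pi * y\<close> into exponent \<open>N - L / 2\<close>,
  an integer since \<open>L\<close> is even, and turns the moment into the Gamma factor.\<close>

lemma gaussian_moment_scalar:
  assumes y: "y > 0" and L: "even L" "L \<le> N"
  shows "(\<i> * of_real (sqrt (2 * pi * y))) ^ L * of_real (- (2 * pi * y)) ^ (N - L)
           * of_real (LINT v|std_normal_distribution. v ^ L)
       = (-1) ^ N * 2 ^ N * of_real (pi powr (real N - real L / 2)) * \<i> ^ L
           * of_real (Gamma ((real L + 1) / 2) / sqrt pi) * of_real (y powr (real N - real L / 2))"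
proof -
  obtain p where p: "L = 2 * p" using L by blast
  obtain d where d: "N = 2 * p + d" using L by (metis p le_Suc_ex)
  have e: "real N - real L / 2 = real (p + d)" by (simp add: p d)
  have "(sqrt (2 * pi * y)) ^ (2 * p) = (2 * pi * y) ^ p"
    using y by (simp add: power_mult)
  hence w: "(\<i> * of_real (sqrt (2 * pi * y))) ^ L = \<i> ^ L * of_real ((2 * pi * y) ^ p)"
    unfolding power_mult_distrib p by (simp only: of_real_power[symmetric])
  have "(2 * pi * y) ^ p * (- (2 * pi * y)) ^ d * (fact (2 * p) / (2 ^ p * fact p))
      = (-1) ^ d * 2 ^ d * pi ^ (p + d) * (fact (2 * p) / (fact p)) * y ^ (p + d)"
    unfolding power_minus[of "2 * pi * y"] power_mult_distrib power_add by simp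
  \<comment> \<open>As \<open>N = 2 * p + d\<close>, the sign is unchanged and the missing
    \<open>2 ^ (2 * p)\<close> becomes the \<open>4 ^ p\<close> of the Gamma value.\<close>
  also have "(-1) ^ d * 2 ^ d = ((-1) ^ N * 2 ^ N / 4 ^ p :: real)"
    by (simp add: d power_add power_mult)
  finally have re: "(2 * pi * y) ^ p * (- (2 * pi * y)) ^ d * (fact (2 * p) / (2 ^ p * fact p))
      = (-1) ^ N * 2 ^ N * pi ^ (p + d) * (fact (2 * p) / (4 ^ p * fact p)) * y ^ (p + d)"
    by simp
  have "(\<i> * of_real (sqrt (2 * pi * y))) ^ L * of_real (- (2 * pi * y)) ^ (N - L)
           * of_real (LINT v|std_normal_distribution. v ^ L)
      = \<i> ^ L * of_real ((2 * pi * y) ^ p * (- (2 * pi * y)) ^ d * (fact (2 * p) / (2 ^ p * fact p)))"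
    unfolding w unfolding p std_normal_distribution_even_moments by (simp add: d)
  also have "\<dots> = (-1) ^ N * 2 ^ N * of_real (pi powr (real N - real L / 2)) * \<i> ^ L
           * of_real (Gamma ((real L + 1) / 2) / sqrt pi) * of_real (y powr (real N - real L / 2))"
    unfolding re e powr_realpow[OF pi_gt_zero] powr_realpow[OF y] unfolding p Gamma_plus_half_nat
    by simp
  finally show ?thesis .
qed

lemma prod_mode_coeff_eq:
  assumes m: "m \<le> n"
  shows "(\<Prod>j=1..n. mode_coeff m r s j (\<nu> j) (l j))
    = (\<Prod>j=1..m. euler_poly (\<nu> j) 1 * (-1) ^ l j / (fact (l j) * fact (\<nu> j - l j))
                     * (of_nat (r j) + 1/2) ^ (\<nu> j - l j))
      * (\<Prod>j=m+1..n. euler_poly (\<nu> j) 0 / (fact (l j) * fact (\<nu> j - l j))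
                       * (of_nat (s j) + 1/2) ^ (\<nu> j - l j))"
proof -
  have "{1..n} = {1..m} \<union> {m+1..n}" using m by auto
  hence "(\<Prod>j=1..n. mode_coeff m r s j (\<nu> j) (l j))
      = (\<Prod>j=1..m. mode_coeff m r s j (\<nu> j) (l j)) * (\<Prod>j=m+1..n. mode_coeff m r s j (\<nu> j) (l j))"
    by (simp add: prod.union_disjoint)
  also have "\<dots> = (\<Prod>j=1..m. euler_poly (\<nu> j) 1 * (-1) ^ l j / (fact (l j) * fact (\<nu> j - l j))
                     * (of_nat (r j) + 1/2) ^ (\<nu> j - l j))
      * (\<Prod>j=m+1..n. euler_poly (\<nu> j) 0 / (fact (l j) * fact (\<nu> j - l j))
                       * (of_nat (s j) + 1/2) ^ (\<nu> j - l j))"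
    by (intro arg_cong2[of _ _ _ _ "(*)"] prod.cong refl)
      (auto simp: mode_coeff_def mode_arg_def mode_sign_def mode_energy_def)
  finally show ?thesis .
qed

lemma integral_truncated_product:
  assumes m: "m \<le> n" and y: "y > 0"
  shows "complex_integrable std_normal_distribution (truncated_product n m r s K y)"
    and "(CLINT v|std_normal_distribution. truncated_product n m r s K y v) = asym_sum n m r s (real K) y"
proof -
  define F where "F = {g \<in> multi_exponents {1..n}. multi_weight {1..n} g < 2 * K + 2}"
  have fin: "finite F" unfolding F_def by (rule finite_multi_weight_less) auto
  define N where "N g = (\<Sum>j=1..n. fst (g j))" for g :: "nat \<Rightarrow> nat \<times> nat"
  define L where "L g = (\<Sum>j=1..n. snd (g j))" for g :: "nat \<Rightarrow> nat \<times> nat"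
  define c where "c g = (\<Prod>j=1..n. mode_coeff m r s j (fst (g j)) (snd (g j))) / 2 ^ n
      * (\<i> * of_real (sqrt (2 * pi * y))) ^ L g * of_real (- (2 * pi * y)) ^ (N g - L g)" for g
  have le: "snd (g j) \<le> fst (g j)" if "g \<in> F" "j \<in> {1..n}" for g j
    using that by (force simp: F_def exponent_pairs_def PiE_iff)
  have T: "truncated_product n m r s K y = (\<lambda>v. \<Sum>g\<in>F. c g * of_real (v ^ L g))"
    unfolding truncated_product_def F_def[symmetric]
    by (intro ext sum.cong refl, subst prod_mode_term_eq) (auto simp: F_def c_def L_def N_def)
  have int: "complex_integrable std_normal_distribution (\<lambda>v. c g * of_real (v ^ L g))" for g
    by (intro integrable_mult_right integrable_of_real integrable_std_normal_distribution_moment)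
  show "complex_integrable std_normal_distribution (truncated_product n m r s K y)"
    unfolding T by (intro Bochner_Integration.integrable_sum int)
  have weight: "multi_weight {1..n} g = 2 * N g - L g" if "g \<in> F" for g
  proof -
    have "multi_weight {1..n} g = (\<Sum>j=1..n. 2 * fst (g j)) - (\<Sum>j=1..n. snd (g j))"
      unfolding multi_weight_def using le[OF that] by (intro sum_subtractf_nat) (simp add: trans_le_add1 mult_2)
    thus ?thesis by (simp add: N_def L_def sum_distrib_left)
  qed
  have LN: "L g \<le> N g" if "g \<in> F" for g
    unfolding L_def N_def using le[OF that] by (intro sum_mono) auto
  have "(CLINT v|std_normal_distribution. truncated_product n m r s K y v)
      = (\<Sum>g\<in>F. c g * of_real (LINT v|std_normal_distribution. v ^ L g))"
    unfolding T by (subst Bochner_Integration.integral_sum[OF int])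
      (simp only: integral_mult_right_zero integral_complex_of_real)
  \<comment> \<open>Odd Gaussian moments vanish, which is the origin of the parity condition on the
    \<open>l\<close> sum.\<close>
  also have "\<dots> = (\<Sum>g\<in>{g \<in> F. even (L g)}. c g * of_real (LINT v|std_normal_distribution. v ^ L g))"
    using fin by (intro sum.mono_neutral_right) (auto simp: integral_std_normal_distribution_moment_odd)
  also have "\<dots> = (\<Sum>(\<nu>, l)\<in>asym_index n (real K). 1 / 2 ^ n * asym_term n m r s \<nu> l y)"
  \<comment> \<open>The bijection between functions into pairs and pairs of functions; restriction
    to \<open>{1..n}\<close> keeps both sides extensional.\<close>
  proof (rule sum.reindex_bij_witness[where
        j = "\<lambda>g. (\<lambda>k\<in>{1..n}. fst (g k), \<lambda>k\<in>{1..n}. snd (g k))" and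
        i = "\<lambda>(\<nu>, l). \<lambda>k\<in>{1..n}. (\<nu> k, l k)"])
    fix g assume g: "g \<in> {g \<in> F. even (L g)}"
    show "(\<lambda>(\<nu>, l). \<lambda>k\<in>{1..n}. (\<nu> k, l k)) (\<lambda>k\<in>{1..n}. fst (g k), \<lambda>k\<in>{1..n}. snd (g k)) = g"
      using g by (auto simp: F_def PiE_iff extensional_def fun_eq_iff restrict_def)
    have "2 * N g - L g < 2 * K + 2" using weight[of g] g by (auto simp: F_def)
    moreover obtain p where p: "L g = 2 * p" using g by blast
    \<comment> \<open>With \<open>L g = 2 * p\<close> the weight is even, so the cutoff
      \<open>< 2 * K + 2\<close> says exactly \<open>N g - p \<le> K\<close>.\<close>
    ultimately have "N g \<le> K + p" by linarith
    hence "real (N g) - real (L g) / 2 \<le> real K" using p by simp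
    thus "(\<lambda>k\<in>{1..n}. fst (g k), \<lambda>k\<in>{1..n}. snd (g k)) \<in> asym_index n (real K)"
      using g le[of g] by (simp add: asym_index_def N_def L_def)
    have "(case (\<lambda>k\<in>{1..n}. fst (g k), \<lambda>k\<in>{1..n}. snd (g k)) of (\<nu>, l) \<Rightarrow> 1 / 2 ^ n * asym_term n m r s \<nu> l y)
        = 1 / 2 ^ n * ((-1) ^ N g * 2 ^ N g * of_real (pi powr (real (N g) - real (L g) / 2)) * \<i> ^ L g
           * of_real (Gamma ((real (L g) + 1) / 2) / sqrt pi)
           * (\<Prod>j=1..n. mode_coeff m r s j (fst (g j)) (snd (g j))) * of_real (y powr (real (N g) - real (L g) / 2)))"
    proof -
      have 1: "(\<Sum>k=1..n. (\<lambda>k\<in>{1..n}. fst (g k)) k) = N g" "(\<Sum>k=1..n. (\<lambda>k\<in>{1..n}. snd (g k)) k) = L g"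
        by (simp_all add: N_def L_def)
      have "(\<Prod>j=1..n. mode_coeff m r s j (fst (g j)) (snd (g j)))
          = (\<Prod>j=1..n. mode_coeff m r s j ((\<lambda>k\<in>{1..n}. fst (g k)) j) ((\<lambda>k\<in>{1..n}. snd (g k)) j))"
        by (intro prod.cong) auto
      thus ?thesis
        unfolding prod.case asym_term_def 1 Let_def prod_mode_coeff_eq[OF m] by (simp only: mult.assoc)
    qed
    also have "\<dots> = (\<Prod>j=1..n. mode_coeff m r s j (fst (g j)) (snd (g j))) / 2 ^ n
         * ((-1) ^ N g * 2 ^ N g * of_real (pi powr (real (N g) - real (L g) / 2)) * \<i> ^ L g
           * of_real (Gamma ((real (L g) + 1) / 2) / sqrt pi) * of_real (y powr (real (N g) - real (L g) / 2)))"
      by (simp only: divide_inverse mult_1_left mult_ac)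
    also have "\<dots> = c g * of_real (LINT v|std_normal_distribution. v ^ L g)"
      using g LN[of g] by (subst gaussian_moment_scalar[OF y, symmetric]) (auto simp only: c_def mult.assoc mem_Collect_eq)
    finally show "(case (\<lambda>k\<in>{1..n}. fst (g k), \<lambda>k\<in>{1..n}. snd (g k)) of (\<nu>, l) \<Rightarrow> 1 / 2 ^ n * asym_term n m r s \<nu> l y)
        = c g * of_real (LINT v|std_normal_distribution. v ^ L g)" .
  next
    fix b assume b: "b \<in> asym_index n (real K)"
    obtain \<nu> l where \<nu>l: "b = (\<nu>, l)" by (cases b)
    have *: "\<nu> \<in> {1..n} \<rightarrow>\<^sub>E UNIV" "l \<in> (\<Pi>\<^sub>E k\<in>{1..n}. {0..\<nu> k})" "even (\<Sum>k=1..n. l k)"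
      "real (\<Sum>k=1..n. \<nu> k) - real (\<Sum>k=1..n. l k) / 2 \<le> real K"
      using b by (auto simp: \<nu>l asym_index_def)
    let ?g = "\<lambda>k\<in>{1..n}. (\<nu> k, l k)"
    have l_le: "l k \<le> \<nu> k" if "k \<in> {1..n}" for k using *(2) that by (auto simp: PiE_iff)
    show "(\<lambda>g. (\<lambda>k\<in>{1..n}. fst (g k), \<lambda>k\<in>{1..n}. snd (g k))) ((\<lambda>(\<nu>, l). \<lambda>k\<in>{1..n}. (\<nu> k, l k)) b) = b"
      using *(1,2) by (auto simp: \<nu>l PiE_iff extensional_def fun_eq_iff restrict_def)
    have sums: "N ?g = (\<Sum>k=1..n. \<nu> k)" "L ?g = (\<Sum>k=1..n. l k)"
      by (simp_all add: N_def L_def)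
    have "multi_weight {1..n} ?g = (\<Sum>k=1..n. 2 * \<nu> k - l k)"
      by (simp add: multi_weight_def)
    also have "\<dots> = (\<Sum>k=1..n. 2 * \<nu> k) - (\<Sum>k=1..n. l k)"
      using l_le by (intro sum_subtractf_nat) (simp add: trans_le_add1 mult_2)
    also have "\<dots> = 2 * (\<Sum>k=1..n. \<nu> k) - (\<Sum>k=1..n. l k)" by (simp add: sum_distrib_left)
    also have "\<dots> < 2 * K + 2" using *(4) by linarith
    finally have "?g \<in> F" using l_le by (auto simp: F_def exponent_pairs_def)
    thus "(\<lambda>(\<nu>, l). \<lambda>k\<in>{1..n}. (\<nu> k, l k)) b \<in> {g \<in> F. even (L g)}"
      using *(3) sums(2) by (simp add: \<nu>l)
  qed
  also have "\<dots> = asym_sum n m r s (real K) y"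
    unfolding asym_sum_def by (simp add: sum_distrib_left split_beta)
  finally show "(CLINT v|std_normal_distribution. truncated_product n m r s K y v) = asym_sum n m r s (real K) y" .
qed

text \<open>Integrating the pointwise error turns the powers of \<open>v\<close> into factorials.
  \<open>B\<close> and \<open>C\<close> do not depend on \<open>K\<close>, so \<open>K\<close> may
  later be chosen in terms of \<open>y\<close>.\<close>

lemma G_coeff_remainder:
  fixes smul :: "complex \<Rightarrow> 'f::ab_group_add \<Rightarrow> 'f"
  assumes fock: "fermionic_fock_space smul psi psis vac"
    and m: "m \<le> n" and inj_r: "inj_on r {1..m}" and inj_s: "inj_on s {m+1..n}"
  obtains B C y0 where "B > 0" "C > 0" "y0 > 0"
    "\<And>y K. 0 < y \<Longrightarrow> y < y0 \<Longrightarrow>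
       cmod (G_coeff smul psi psis vac n m r s (\<i> * of_real y) - asym_sum n m r s (real K) y)
         \<le> C * (B * y) ^ (K + 1) * fact (K + 1)"
proof -
  interpret real_distribution std_normal_distribution by (rule real_dist_normal_dist)
  obtain \<beta> C y0 where \<beta>: "\<beta> > 0" and C: "C > 0" and y0: "0 < y0" "y0 \<le> 1"
    and bound: "\<And>y v K. 0 < y \<Longrightarrow> y < y0 \<Longrightarrow>
       cmod ((\<Prod>j=1..n. fermi_factor m r s y v j) - truncated_product n m r s K y v)
         \<le> C * (\<beta> * y) ^ (K + 1) * (v ^ (2 * (K + 1)) + 1 + v ^ (2 * (K + 1 + n)))"
    using fermi_product_remainder[where n = n and m = m and r = r and s = s] by blast
  \<comment> \<open>In units of \<open>4 ^ (K + 1) * fact (K + 1)\<close>, the first moment and the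
    constant 1 cost at most 1 each, the moment raised by \<open>n\<close> costs at most
    \<open>4 ^ n * fact n\<close>.\<close>
  let ?D = "2 + 4 ^ n * fact n :: real"
  have "cmod (G_coeff smul psi psis vac n m r s (\<i> * of_real y) - asym_sum n m r s (real K) y)
      \<le> (C * ?D) * (4 * \<beta> * y) ^ (K + 1) * fact (K + 1)" if y: "0 < y" "y < y0" for y K
  proof -
    let ?f = "\<lambda>v. \<Prod>j=1..n. fermi_factor m r s y v j" and ?T = "truncated_product n m r s K y"
    define a where "a = C * (\<beta> * y) ^ (K + 1)"
    have a: "a \<ge> 0" using C \<beta> y by (simp add: a_def)
    have f: "complex_integrable std_normal_distribution ?f"
      using y y0 by (intro integrable_fermi_product) auto
    note T = integral_truncated_product[OF m y(1), of r s K]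
    have mom: "integrable std_normal_distribution (\<lambda>v. v ^ k :: real)" for k
      by (rule integrable_std_normal_distribution_moment)
    have "G_coeff smul psi psis vac n m r s (\<i> * of_real y) - asym_sum n m r s (real K) y
        = (CLINT v|std_normal_distribution. ?f v - ?T v)"
      unfolding G_coeff_eq_integral[OF fock m inj_r inj_s y(1)] T(2)[symmetric]
      by (rule Bochner_Integration.integral_diff[OF f T(1), symmetric])
    hence "cmod (G_coeff smul psi psis vac n m r s (\<i> * of_real y) - asym_sum n m r s (real K) y)
        \<le> (LINT v|std_normal_distribution. cmod (?f v - ?T v))"
      by (simp add: integral_norm_bound)
    also have "\<dots> \<le> (LINT v|std_normal_distribution. a * (v ^ (2 * (K + 1)) + 1 + v ^ (2 * (K + 1 + n))))"
    proof (rule integral_mono)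
      show "cmod (?f v - ?T v) \<le> a * (v ^ (2 * (K + 1)) + 1 + v ^ (2 * (K + 1 + n)))" for v
        unfolding a_def by (rule bound[OF y])
    qed (intro integrable_norm Bochner_Integration.integrable_diff f T(1) integrable_mult_right
          Bochner_Integration.integrable_add mom integrable_const)+
    also have "\<dots> = a * ((LINT v|std_normal_distribution. v ^ (2 * (K + 1))) + 1
        + (LINT v|std_normal_distribution. v ^ (2 * (K + 1 + n))))"
      using prob_space
      by (simp only: integral_mult_right_zero Bochner_Integration.integral_add mom integrable_const
          Bochner_Integration.integrable_add lebesgue_integral_const scaleR_conv_of_real of_real_1 mult_1_left)
    also have "\<dots> \<le> a * (4 ^ (K + 1) * fact (K + 1) * ?D)"
    proof (rule mult_left_mono[OF _ a])
      have "(2 :: real) ^ (K + 1) * fact (K + 1) \<le> 4 ^ (K + 1) * fact (K + 1)"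
        by (intro mult_right_mono power_mono) auto
      moreover have "1 \<le> 4 ^ (K + 1) * (fact (K + 1) :: real)"
        using mult_mono[of 1 "4 ^ (K + 1)" 1 "fact (K + 1) :: real"] by (simp add: fact_ge_1 one_le_power del: power_Suc fact_Suc)
      moreover have "2 ^ (K + 1 + n) * fact (K + 1 + n) \<le> 4 ^ (K + 1) * fact (K + 1) * (4 ^ n * fact n :: real)"
      proof -
        have "2 ^ (K + 1 + n) * fact (K + 1 + n) \<le> 2 ^ (K + 1 + n) * (2 ^ (K + 1 + n) * fact (K + 1) * fact n :: real)"
          by (intro mult_left_mono fact_add_le) auto
        also have "\<dots> = (2 * 2) ^ (K + 1 + n) * fact (K + 1) * fact n"
          by (simp only: power_mult_distrib mult_ac)
        also have "\<dots> = 4 ^ (K + 1) * fact (K + 1) * (4 ^ n * fact n)"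
          by (simp only: power_add mult_ac) simp
        finally show ?thesis .
      qed
      ultimately show "(LINT v|std_normal_distribution. v ^ (2 * (K + 1))) + 1
        + (LINT v|std_normal_distribution. v ^ (2 * (K + 1 + n))) \<le> 4 ^ (K + 1) * fact (K + 1) * ?D"
        using std_normal_even_moment_le[of "K + 1"] std_normal_even_moment_le[of "K + 1 + n"]
        unfolding distrib_left[of _ 2] by linarith
    qed
    also have "\<dots> = (C * ?D) * (4 * \<beta> * y) ^ (K + 1) * fact (K + 1)"
      unfolding a_def mult.assoc[of 4] power_mult_distrib[of 4] by (simp only: mult_ac)
    finally show ?thesis .
  qed
  moreover have "?D > 0" by (simp add: add_pos_pos)
  ultimately show ?thesis
    using that[of "4 * \<beta>" "C * ?D" y0] \<beta> C y0 by simp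
qed

text \<open>Because the \<open>l\<close> sum is even, all exponents of \<open>y\<close> are
  integers, so a real cutoff acts like its floor.\<close>

lemma asym_index_floor:
  assumes "x \<ge> 0"
  shows "asym_index n x = asym_index n (real (nat \<lfloor>x\<rfloor>))"
proof -
  have "real N - real L / 2 \<le> x \<longleftrightarrow> real N - real L / 2 \<le> real (nat \<lfloor>x\<rfloor>)" if "even L" for N L :: nat
  proof -
    obtain p where p: "L = 2 * p" using \<open>even L\<close> by blast
    have "real N - real L / 2 = of_int (int N - int p)" by (simp add: p)
    moreover have "real (nat \<lfloor>x\<rfloor>) = of_int \<lfloor>x\<rfloor>" using assms by simp
    moreover have "of_int (int N - int p) \<le> x \<longleftrightarrow> int N - int p \<le> \<lfloor>x\<rfloor>" by (rule le_floor_iff[symmetric])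
    ultimately show ?thesis by (simp only: of_int_le_iff)
  qed
  thus ?thesis unfolding asym_index_def by blast
qed

text \<open>The series is read as an asymptotic expansion to every fixed order and, for the
  exponentially small error, as truncated at an order proportional to \<open>1 / y\<close>. Both
  readings follow from the factorial error bound.\<close>

theorem theorem3p4:
  fixes smul :: "complex \<Rightarrow> 'f::ab_group_add \<Rightarrow> 'f"
    and psi psis :: "int \<Rightarrow> 'f \<Rightarrow> 'f" and vac :: 'f
    and n m :: nat and r s :: "nat \<Rightarrow> nat"
  assumes fock: "fermionic_fock_space smul psi psis vac"
    and n: "n \<ge> 1" and m: "m \<le> n"
    and r_decreasing: "\<And>i j. 1 \<le> i \<Longrightarrow> i < j \<Longrightarrow> j \<le> m \<Longrightarrow> r i > r j"
    and s_decreasing: "\<And>i j. m + 1 \<le> i \<Longrightarrow> i < j \<Longrightarrow> j \<le> n \<Longrightarrow> s i > s j"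
    and r_s: "\<And>j k. j \<in> {1..m} \<Longrightarrow> k \<in> {m+1..n} \<Longrightarrow> - real (r j) - 1/2 \<noteq> real (s k) + 1/2"
  shows "(\<forall>K::nat. (\<lambda>y. cmod (G_coeff smul psi psis vac n m r s (\<i> * of_real y)
                              - asym_sum n m r s (real K) y))
              \<in> O[at_right 0](\<lambda>y. y ^ (K + 1))) \<and>
         (\<exists>a>0. \<exists>\<kappa>>0. (\<lambda>y. cmod (G_coeff smul psi psis vac n m r s (\<i> * of_real y)
                                    - asym_sum n m r s (\<kappa> / y) y))
              \<in> O[at_right 0](\<lambda>y. exp (- a / y)))"
proof -
  have inj_r: "inj_on r {1..m}"
    by (rule linorder_inj_onI) (use r_decreasing in \<open>force+\<close>)
  have inj_s: "inj_on s {m+1..n}"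
    by (rule linorder_inj_onI) (use s_decreasing in \<open>force+\<close>)
  let ?E = "\<lambda>K y. cmod (G_coeff smul psi psis vac n m r s (\<i> * of_real y) - asym_sum n m r s K y)"
  obtain B C y0 where B: "B > 0" and C: "C > 0" and y0: "y0 > 0"
    and bound: "\<And>y K. 0 < y \<Longrightarrow> y < y0 \<Longrightarrow> ?E (real K) y \<le> C * (B * y) ^ (K + 1) * fact (K + 1)"
    using G_coeff_remainder[OF fock m inj_r inj_s] by blast
  have "?E (real K) \<in> O[at_right 0](\<lambda>y. y ^ (K + 1))" for K
  proof (rule bigoI[where c = "C * B ^ (K + 1) * fact (K + 1)"])
    show "\<forall>\<^sub>F y in at_right 0. norm (?E (real K) y) \<le> C * B ^ (K + 1) * fact (K + 1) * norm (y ^ (K + 1))"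
      using eventually_at_right_real[OF y0]
    proof eventually_elim
      case (elim y)
      have "?E (real K) y \<le> C * (B * y) ^ (K + 1) * fact (K + 1)" using elim by (intro bound) auto
      also have "\<dots> = C * B ^ (K + 1) * fact (K + 1) * \<bar>y ^ (K + 1)\<bar>"
        using elim by (simp only: power_mult_distrib mult_ac) simp
      finally show ?case by simp
    qed
  qed
  \<comment> \<open>With \<open>K + 1 \<le> 2 * \<kappa> / y\<close> this makes
    \<open>B * y * (K + 1) \<le> exp (-1)\<close>, so each of the \<open>K + 1\<close> factors gains
    \<open>1/e\<close>.\<close>
  moreover define \<kappa> where "\<kappa> = exp (-1) / (2 * B)"
  have \<kappa>: "\<kappa> > 0" using B by (simp add: \<kappa>_def)
  have "(\<lambda>y. ?E (\<kappa> / y) y) \<in> O[at_right 0](\<lambda>y. exp (- \<kappa> / y))"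
  proof (rule bigoI[where c = C])
    \<comment> \<open>Requiring \<open>y < \<kappa>\<close> gives
      \<open>\<kappa> / y \<ge> 1\<close>, which is what bounds \<open>K + 1\<close> by
      \<open>2 * \<kappa> / y\<close>.\<close>
    have "min y0 \<kappa> > 0" using y0 \<kappa> by simp
    from eventually_at_right_real[OF this]
    show "\<forall>\<^sub>F y in at_right 0. norm (?E (\<kappa> / y) y) \<le> C * norm (exp (- \<kappa> / y))"
    proof eventually_elim
      case (elim y)
      hence y: "0 < y" "y < y0" "y < \<kappa>" by auto
      define K where "K = nat \<lfloor>\<kappa> / y\<rfloor>"
      have pos: "\<kappa> / y \<ge> 1" using y by simp
      have K: "real K \<le> \<kappa> / y" "\<kappa> / y < real K + 1"
        using pos unfolding K_def by linarith+
      have "?E (\<kappa> / y) y = ?E (real K) y"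
        unfolding asym_sum_def K_def using asym_index_floor[of "\<kappa> / y" n] pos by simp
      also have "\<dots> \<le> C * (B * y) ^ (K + 1) * fact (K + 1)"
        using y by (intro bound) auto
      also have "\<dots> \<le> C * (B * y) ^ (K + 1) * real (K + 1) ^ (K + 1)"
      proof (rule mult_left_mono)
        show "fact (K + 1) \<le> real (K + 1) ^ (K + 1)"
          using fact_le_power[of "K + 1", where 'a = real] by (simp only: of_nat_power)
      qed (use C B y in auto)
      also have "\<dots> = C * (B * y * real (K + 1)) ^ (K + 1)"
        by (simp only: power_mult_distrib mult_ac)
      also have "\<dots> \<le> C * exp (-1) ^ (K + 1)"
      proof (intro mult_left_mono power_mono)
        have "real (K + 1) \<le> 2 * (\<kappa> / y)" using K pos by simp
        hence "B * y * real (K + 1) \<le> B * y * (2 * (\<kappa> / y))"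
          using B y by (intro mult_left_mono) auto
        also have "\<dots> = exp (-1)" using B y by (simp add: \<kappa>_def)
        finally show "B * y * real (K + 1) \<le> exp (-1)" .
      qed (use B C y in auto)
      also have "exp (-1) ^ (K + 1) = exp (- real (K + 1))"
        by (simp only: exp_of_nat_mult[symmetric] mult_minus_right mult_1_right)
      \<comment> \<open>The floor satisfies \<open>K + 1 > \<kappa> / y\<close>, so the decay rate
        \<open>a\<close> can be taken equal to \<open>\<kappa>\<close>.\<close>
      also have "C * \<dots> \<le> C * exp (- \<kappa> / y)"
        using K C by (intro mult_left_mono) auto
      finally show ?case by simp
    qed
  qed
  ultimately show ?thesis using \<kappa> by blast
qed

end
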